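(* Let $X$ be a separable KB-space and let $T_n=(T_n(t))_{t>0}$, $n\in\mathbb N$, be an increasing sequence of positive and contractive $*$-semigroups on $X^*$ (i.e. $T_n(t)\le T_{n+1}(t)$ for all $n\in\mathbb N$ and $t>0$) with Laplace transforms $(R_n(\lambda))_{\mathrm{Re}\,\lambda>0}$. Then $T(t):=\sup_{n\in\mathbb N}T_n(t)$, $t>0$, defines a positive and contractive $*$-semigroup on $X^*$, whose Laplace transform $(R(\lambda))_{\mathrm{Re}\,\lambda>0}$ satisfies $R(\lambda)=\sup_{n\in\mathbb N}R_n(\lambda)$ for all real $\lambda>0$.
   Context: A Banach lattice is a KB-space if every increasing norm-bounded net of positive vectors converges in norm. $X^*$ is the dual of $X$, ordered by the dual cone $X^*_+=\{x^*:\langle x^*,x\rangle\ge0\ \forall x\in X_+\}$. An operator $S$ on $X^*$ is positive if $SX^*_+\subset X^*_+$, and $S_1\le S_2$ means $S_2-S_1$ is positive. For an increasing sequence $(U_n)$ of positive contractions on $X^*$, $U=\sup_nU_n$ means the operator with $Ux^*=\sup_nU_nx^*$ for all $x^*\in X^*_+$. (Scalars are complex; a Banach lattice is understood via its complexification where non-real scalars occur.) A $*$-semigroup on $X^*$ is a family $T=(T(t))_{t>0}$ of weak$^*$-continuous (with respect to $\sigma(X^*,X)$) linear operators on $X^*$ with $T(t+s)=T(t)T(s)$ for all $t,s>0$ such that $t\mapsto\langle T(t)x^*,x\rangle$ is measurable for all $x^*\in X^*$, $x\in X$. It is contractive if $\|T(t)\|\le1$ for all $t>0$, and positive if every $T(t)$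 is positive. No continuity at $t=0$ and no injectivity is assumed. The Laplace transform of a contractive $*$-semigroup is the family of operators on $X^*$ given by $\langle R(\lambda)x^*,x\rangle=\int_0^\infty e^{-\lambda t}\langle T(t)x^*,x\rangle\,dt$, $\mathrm{Re}\,\lambda>0$. *)

theory Defs
  imports "HOL-Analysis.Analysis" "HOL-Library.Lattice_Algebras" "HOL-Library.Lub_Glb"
begin

section \<open>Banach lattices and KB-spaces\<close>

class banach_lattice = banach + ordered_real_vector + lattice_ab_group_add_abs +
  assumes norm_mono_abs: "\<bar>x\<bar> \<le> \<bar>y\<bar> \<Longrightarrow> norm x \<le> norm y"

definition directed_preorder :: "'i set \<Rightarrow> ('i \<Rightarrow> 'i \<Rightarrow> bool) \<Rightarrow> bool"
  where "directed_preorder I r \<longleftrightarrow>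
    I \<noteq> {} \<and> (\<forall>i\<in>I. r i i) \<and> (\<forall>i\<in>I. \<forall>j\<in>I. \<forall>k\<in>I. r i j \<longrightarrow> r j k \<longrightarrow> r i k) \<and>
    (\<forall>i\<in>I. \<forall>j\<in>I. \<exists>k\<in>I. r i k \<and> r j k)"

text \<open>A class axiom cannot quantify over types, so it speaks of nets whose index set is a subset
  of the space itself. An increasing net has the same limit behaviour as the directed set of its
  values, so this covers all index types; see \<open>kb_space_nets\<close> below.\<close>

class kb_space = banach_lattice +
  assumes increasing_bounded_nets_converge:
    "directed_preorder (I :: 'a set) r \<Longrightarrow>
     (\<forall>i\<in>I. \<forall>j\<in>I. r i j \<longrightarrow> u i \<le> u j) \<Longrightarrow>
     (\<forall>i\<in>I. 0 \<le> u i) \<Longrightarrow>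
     (\<exists>M. \<forall>i\<in>I. norm (u i) \<le> M) \<Longrightarrow>
     (\<exists>l :: 'a. \<forall>e>0. \<exists>i0\<in>I. \<forall>i\<in>I. r i0 i \<longrightarrow> norm (u i - l) < e)"

lemma kb_space_nets:
  fixes I :: "'i set" and u :: "'i \<Rightarrow> 'a::kb_space"
  assumes dir: "directed_preorder I r"
    and mono: "\<forall>i\<in>I. \<forall>j\<in>I. r i j \<longrightarrow> u i \<le> u j"
    and pos: "\<forall>i\<in>I. 0 \<le> u i"
    and bdd: "\<exists>M. \<forall>i\<in>I. norm (u i) \<le> M"
  shows "\<exists>l. \<forall>e>0. \<exists>i0\<in>I. \<forall>i\<in>I. r i0 i \<longrightarrow> norm (u i - l) < e"
proof -
  have "directed_preorder (u ` I) (\<le>)"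
    unfolding directed_preorder_def
  proof (intro conjI ballI impI)
    show "u ` I \<noteq> {}" using dir by (auto simp: directed_preorder_def)
    fix x y assume "x \<in> u ` I" "y \<in> u ` I"
    then obtain i j where ij: "i \<in> I" "j \<in> I" "x = u i" "y = u j" by blast
    then obtain k where "k \<in> I" "r i k" "r j k" using dir unfolding directed_preorder_def by blast
    then show "\<exists>z\<in>u ` I. x \<le> z \<and> y \<le> z" using ij mono by blast
  qed auto
  then have "\<exists>l. \<forall>e>0. \<exists>x0\<in>u ` I. \<forall>x\<in>u ` I. x0 \<le> x \<longrightarrow> norm (x - l) < e"
    using increasing_bounded_nets_converge[of "u ` I" "(\<le>)" "\<lambda>x. x"] pos bdd by auto
  then obtain l where l: "\<And>e. e > 0 \<Longrightarrow> \<exists>x0\<in>u ` I. \<forall>x\<in>u ` I. x0 \<le> x \<longrightarrow> norm (x - l) < e"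
    by blast
  have "\<exists>i0\<in>I. \<forall>i\<in>I. r i0 i \<longrightarrow> norm (u i - l) < e" if "e > 0" for e
    using l[OF that] mono by blast
  then show ?thesis by blast
qed

section \<open>The complexification\<close>

datatype 'a complexification = Cplx (cre: 'a) (cim: 'a)

instantiation complexification :: (real_vector) real_vector
begin

definition "0 = Cplx 0 0"
definition "z + w = Cplx (cre z + cre w) (cim z + cim w)"
definition "- z = Cplx (- cre z) (- cim z)"
definition "z - w = Cplx (cre z - cre w) (cim z - cim w)"
definition "a *\<^sub>R z = Cplx (a *\<^sub>R cre z) (a *\<^sub>R cim z)"

instance
  by standard
    (auto simp: zero_complexification_def plus_complexification_def uminus_complexification_def
      minus_complexification_def scaleR_complexification_def algebra_simps)

end

definition scaleC :: "complex \<Rightarrow> 'a::real_vector complexification \<Rightarrow> 'a complexification"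
  where "scaleC c z = Cplx (Re c *\<^sub>R cre z - Im c *\<^sub>R cim z) (Re c *\<^sub>R cim z + Im c *\<^sub>R cre z)"

definition rotations :: "'a::real_vector complexification \<Rightarrow> 'a set"
  where "rotations z = range (\<lambda>\<theta>. cos \<theta> *\<^sub>R cre z + sin \<theta> *\<^sub>R cim z)"

text \<open>\<open>|x + iy| = sup {cos \<theta> x + sin \<theta> y | \<theta>}\<close>; the supremum exists in every
  Banach lattice, by \<open>isLub_modulus\<close>.\<close>

definition modulus :: "'a::banach_lattice complexification \<Rightarrow> 'a"
  where "modulus z = (THE m. isLub UNIV (rotations z) m)"

lemma isLub_UNIV_iff:
  "isLub UNIV S (m::'a::order) \<longleftrightarrow> (\<forall>x\<in>S. x \<le> m) \<and> (\<forall>u. (\<forall>x\<in>S. x \<le> u) \<longrightarrow> m \<le> u)"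
  by (auto simp: isLub_def isUb_def leastP_def setle_def setge_def)

lemma abs_cos_diff_le: "\<bar>cos x - cos y\<bar> \<le> \<bar>x - y\<bar>" for x y :: real
proof -
  have "norm (cos x - cos y) \<le> 1 * norm (x - y)"
    by (rule field_differentiable_bound[of UNIV cos "\<lambda>x. - sin x"])
      (auto intro!: derivative_eq_intros)
  then show ?thesis by simp
qed

lemma abs_sin_diff_le: "\<bar>sin x - sin y\<bar> \<le> \<bar>x - y\<bar>" for x y :: real
proof -
  have "norm (sin x - sin y) \<le> 1 * norm (x - y)"
    by (rule field_differentiable_bound[of UNIV sin cos])
      (auto intro!: derivative_eq_intros)
  then show ?thesis by simp
qed

lemma abs_scaleR_lattice: "\<bar>a *\<^sub>R x\<bar> \<le> \<bar>a\<bar> *\<^sub>R \<bar>x::'a::banach_lattice\<bar>"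
proof (rule abs_leI)
  have "x \<le> \<bar>x\<bar>" "- x \<le> \<bar>x\<bar>" by (auto simp: abs_ge_self abs_ge_minus_self)
  then have le: "b *\<^sub>R x \<le> b *\<^sub>R \<bar>x\<bar>" "b *\<^sub>R (- x) \<le> b *\<^sub>R \<bar>x\<bar>" if "0 \<le> b" for b
    using that by (auto intro: scaleR_left_mono simp del: scaleR_minus_right)
  show "a *\<^sub>R x \<le> \<bar>a\<bar> *\<^sub>R \<bar>x\<bar>" "- (a *\<^sub>R x) \<le> \<bar>a\<bar> *\<^sub>R \<bar>x\<bar>"
    using le[of a] le[of "-a"] by (auto simp: abs_real_def)
qed

lemma norm_abs_lattice [simp]: "norm \<bar>x::'a::banach_lattice\<bar> = norm x"
  by (intro antisym norm_mono_abs) auto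

lemma LIMSEQ_lattice_le:
  fixes X :: "nat \<Rightarrow> 'a::banach_lattice"
  assumes lim: "X \<longlonglongrightarrow> l" and le: "\<And>n. n \<ge> N \<Longrightarrow> a \<le> X n"
  shows "a \<le> l"
proof -
  let ?p = "sup (a - l) 0"
  have "norm ?p \<le> norm (X n - l)" if "n \<ge> N" for n
  proof (rule norm_mono_abs)
    have "a - l \<le> X n - l" using le[OF that] by simp
    also have "\<dots> \<le> \<bar>X n - l\<bar>" by (rule abs_ge_self)
    finally have "?p \<le> \<bar>X n - l\<bar>" by simp
    moreover have "\<bar>?p\<bar> = ?p" by (rule abs_of_nonneg) simp
    ultimately show "\<bar>?p\<bar> \<le> \<bar>X n - l\<bar>" by simp
  qed
  moreover have "(\<lambda>n. norm (X n - l)) \<longlonglongrightarrow> 0"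
    using lim by (simp add: LIM_zero tendsto_norm_zero)
  ultimately have "norm ?p \<le> 0"
    by (intro LIMSEQ_le_const[of "\<lambda>n. norm (X n - l)"]) auto
  then have "sup (a - l) 0 = 0" by simp
  then have "a - l \<le> 0" by (metis sup_ge1)
  then show ?thesis by simp
qed

lemma LIMSEQ_lattice_ge:
  fixes X :: "nat \<Rightarrow> 'a::banach_lattice"
  assumes "X \<longlonglongrightarrow> l" and "\<And>n. n \<ge> N \<Longrightarrow> X n \<le> a"
  shows "l \<le> a"
  using LIMSEQ_lattice_le[of "\<lambda>n. - X n" "- l" N "- a"] assms by (auto intro: tendsto_minus)

lemma rotations_has_Lub:
  fixes z :: "'a::banach_lattice complexification"
  shows "\<exists>m. isLub UNIV (rotations z) m"
proof -
  define D where "D \<theta> = cos \<theta> *\<^sub>R cre z + sin \<theta> *\<^sub>R cim z" for \<theta>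
  define w where "w = \<bar>cre z\<bar> + \<bar>cim z\<bar>"
  have w0: "0 \<le> w" unfolding w_def by simp
  define A where "A k = (\<lambda>j. real_of_int j / 2 ^ k) ` {- (4 * 2 ^ k) .. 4 * 2 ^ k :: int}" for k :: nat
  define M where "M k = Sup_fin (D ` A k)" for k
  have fin: "finite (D ` A k)" "D ` A k \<noteq> {}" for k
    by (auto simp: A_def)
  have D_diff: "D \<theta> \<le> D \<eta> + d *\<^sub>R w" if "\<bar>\<theta> - \<eta>\<bar> \<le> d" for \<theta> \<eta> d
  proof -
    have "D \<theta> - D \<eta> = (cos \<theta> - cos \<eta>) *\<^sub>R cre z + (sin \<theta> - sin \<eta>) *\<^sub>R cim z"
      by (simp add: D_def algebra_simps)
    also have "\<dots> \<le> \<bar>(cos \<theta> - cos \<eta>) *\<^sub>R cre z\<bar> + \<bar>(sin \<theta> - sin \<eta>) *\<^sub>R cim z\<bar>"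
      by (intro add_mono abs_ge_self)
    also have "\<dots> \<le> \<bar>cos \<theta> - cos \<eta>\<bar> *\<^sub>R \<bar>cre z\<bar> + \<bar>sin \<theta> - sin \<eta>\<bar> *\<^sub>R \<bar>cim z\<bar>"
      by (intro add_mono abs_scaleR_lattice)
    also have "\<dots> \<le> d *\<^sub>R \<bar>cre z\<bar> + d *\<^sub>R \<bar>cim z\<bar>"
      using that abs_cos_diff_le[of \<theta> \<eta>] abs_sin_diff_le[of \<theta> \<eta>]
      by (intro add_mono scaleR_right_mono) auto
    finally show ?thesis by (simp add: w_def algebra_simps)
  qed
  have A_dense: "\<exists>\<eta>\<in>A k. \<bar>\<theta> - \<eta>\<bar> \<le> 1 / 2 ^ k" if "\<bar>\<theta>\<bar> \<le> 4" for \<theta> :: real and k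
  proof
    let ?j = "\<lfloor>\<theta> * 2 ^ k\<rfloor>"
    have "\<bar>\<theta> * 2 ^ k - of_int ?j\<bar> \<le> 1" by linarith
    then have "\<bar>\<theta> * 2 ^ k - of_int ?j\<bar> / 2 ^ k \<le> 1 / 2 ^ k"
      by (simp add: divide_right_mono)
    moreover have "\<bar>\<theta> * 2 ^ k - of_int ?j\<bar> / 2 ^ k = \<bar>\<theta> - of_int ?j / 2 ^ k\<bar>"
      by (simp add: abs_if field_simps)
    ultimately show "\<bar>\<theta> - of_int ?j / 2 ^ k\<bar> \<le> 1 / 2 ^ k" by simp
    have "-4 * 2 ^ k \<le> \<theta> * 2 ^ k" "\<theta> * 2 ^ k \<le> 4 * 2 ^ k"
      using that mult_right_mono[of "-4" \<theta> "2 ^ k"] mult_right_mono[of \<theta> 4 "2 ^ k"]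
      by (auto simp: abs_le_iff)
    then have "of_int (- (4 * 2 ^ k)) \<le> \<theta> * 2 ^ k" "\<theta> * 2 ^ k \<le> of_int (4 * 2 ^ k)"
      by simp_all
    then have "- (4 * 2 ^ k) \<le> ?j" "?j \<le> 4 * 2 ^ k"
      by (simp only: le_floor_iff) (metis floor_mono floor_of_int \<open>\<theta> * 2 ^ k \<le> of_int (4 * 2 ^ k)\<close>)
    then show "of_int ?j / 2 ^ k \<in> A k" unfolding A_def by (intro imageI) auto
  qed
  have D_M: "D \<theta> \<le> M k + (1 / 2 ^ k) *\<^sub>R w" if th: "\<bar>\<theta>\<bar> \<le> 4" for \<theta> k
  proof -
    obtain \<eta> where \<eta>: "\<eta> \<in> A k" "\<bar>\<theta> - \<eta>\<bar> \<le> 1 / 2 ^ k" using A_dense[OF th] by blast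
    have "D \<eta> \<le> M k" unfolding M_def using \<eta>(1) fin by (intro Sup_fin.coboundedI) auto
    then show ?thesis using D_diff[OF \<eta>(2)] by (meson add_right_mono order_trans)
  qed
  have A4: "\<bar>\<eta>\<bar> \<le> 4" if el: "\<eta> \<in> A k" for \<eta> k
  proof -
    obtain j where j: "\<eta> = of_int j / 2 ^ k" "- (4 * 2 ^ k) \<le> j" "j \<le> 4 * 2 ^ k"
      using el by (auto simp: A_def)
    have "real_of_int (- (4 * 2 ^ k)) \<le> of_int j" "of_int j \<le> real_of_int (4 * 2 ^ k)"
      using j by (simp_all only: of_int_le_iff)
    then have "\<eta> \<le> 4" "- 4 \<le> \<eta>"
      unfolding j(1) by (simp_all add: pos_divide_le_eq pos_le_divide_eq)
    then show ?thesis by linarith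
  qed
  have M_M: "M l \<le> M k + (1 / 2 ^ k) *\<^sub>R w" for k l
    unfolding M_def[of l] using A4 D_M fin by (intro Sup_fin.boundedI) auto
  have MM_norm: "norm (M l - M k) \<le> (1 / 2 ^ min k l) * norm w" for k l
  proof -
    have 1: "(1 / 2 ^ i) *\<^sub>R w \<le> (1 / 2 ^ min k l) *\<^sub>R w" if "i = k \<or> i = l" for i
      using w0 that by (intro scaleR_right_mono) (auto intro!: frac_le power_increasing)
    have "M l - M k \<le> (1 / 2 ^ min k l) *\<^sub>R w"
      using M_M[of l k] 1[of k] by (simp add: diff_le_eq add.commute) (meson add_left_mono order_trans)
    moreover have "- (M l - M k) \<le> (1 / 2 ^ min k l) *\<^sub>R w"
      using M_M[of k l] 1[of l] by (simp add: diff_le_eq add.commute) (meson add_left_mono order_trans)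
    ultimately have "\<bar>M l - M k\<bar> \<le> (1 / 2 ^ min k l) *\<^sub>R w" by (rule abs_leI)
    also have "\<dots> \<le> \<bar>(1 / 2 ^ min k l) *\<^sub>R w\<bar>" by (rule abs_ge_self)
    finally have "norm (M l - M k) \<le> norm ((1 / 2 ^ min k l) *\<^sub>R w)" by (rule norm_mono_abs)
    then show ?thesis by simp
  qed
  have small: "(\<lambda>k. (1 / 2 ^ k) * norm w) \<longlonglongrightarrow> 0"
    using tendsto_mult_left_zero[OF LIMSEQ_power_zero[of "1/2::real"], of "norm w"]
    by (simp add: power_divide)
  have "Cauchy M"
  proof (rule metric_CauchyI)
    fix e :: real assume "0 < e"
    then obtain N where N: "\<And>k. k \<ge> N \<Longrightarrow> (1 / 2 ^ k) * norm w < e"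
      using order_tendstoD(2)[OF small] by (auto simp: eventually_sequentially)
    have "dist (M l) (M k) < e" if "l \<ge> N" "k \<ge> N" for l k
      using MM_norm[of l k] N[of "min k l"] that by (simp add: dist_norm)
    then show "\<exists>N. \<forall>l\<ge>N. \<forall>k\<ge>N. dist (M l) (M k) < e" by blast
  qed
  then obtain m where m: "M \<longlonglongrightarrow> m" by (auto simp: Cauchy_convergent_iff convergent_def)
  have "(\<lambda>k. (1 / 2 ^ k) *\<^sub>R w) \<longlonglongrightarrow> 0"
    by (rule tendsto_norm_zero_cancel) (use small in simp)
  then have lim: "(\<lambda>k. M k + (1 / 2 ^ k) *\<^sub>R w) \<longlonglongrightarrow> m" using tendsto_add[OF m] by fastforce
  have upper: "D \<theta> \<le> m" for \<theta>
  proof -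
    obtain t where t: "- pi < t" "t \<le> pi" "sin t = sin \<theta>" "cos t = cos \<theta>"
      using sincos_principal_value[of \<theta>] by auto
    then have "\<bar>t\<bar> \<le> 4" using pi_less_4 by linarith
    then have "D t \<le> m" using LIMSEQ_lattice_le[OF lim] D_M by blast
    then show ?thesis using t by (simp add: D_def)
  qed
  have least: "m \<le> u" if "\<And>\<theta>. D \<theta> \<le> u" for u
  proof (rule LIMSEQ_lattice_ge[OF m])
    show "M k \<le> u" for k unfolding M_def using fin that by (intro Sup_fin.boundedI) auto
  qed
  show ?thesis
    using upper least by (auto simp: isLub_UNIV_iff rotations_def D_def)
qed

lemma isLub_modulus: "isLub UNIV (rotations z) (modulus z)"
proof -
  obtain m where "isLub UNIV (rotations z) m" using rotations_has_Lub by blast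
  moreover have "m' = m" if "isLub UNIV (rotations z) m'" "isLub UNIV (rotations z) m" for m m'
    using that by (meson isLub_UNIV_iff antisym)
  ultimately show ?thesis unfolding modulus_def by (metis theI')
qed

lemma modulus_upper: "cos \<theta> *\<^sub>R cre z + sin \<theta> *\<^sub>R cim z \<le> modulus z"
  using isLub_modulus[of z] by (auto simp: isLub_UNIV_iff rotations_def)

lemma modulus_least:
  assumes "\<And>\<theta>. cos \<theta> *\<^sub>R cre z + sin \<theta> *\<^sub>R cim z \<le> u"
  shows "modulus z \<le> u"
  using isLub_modulus[of z] assms by (auto simp: isLub_UNIV_iff rotations_def)

lemma abs_cre_le_modulus: "\<bar>cre z\<bar> \<le> modulus z"
  using modulus_upper[of 0 z] modulus_upper[of pi z] by (intro abs_leI) auto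

lemma abs_cim_le_modulus: "\<bar>cim z\<bar> \<le> modulus z"
  using modulus_upper[of "pi/2" z] modulus_upper[of "-(pi/2)" z] by (intro abs_leI) auto

lemma modulus_nonneg: "0 \<le> modulus z"
  using abs_cre_le_modulus[of z] abs_ge_zero order_trans by blast

lemma modulus_real: "modulus (Cplx x 0) = \<bar>x\<bar>"
proof (rule antisym)
  show "modulus (Cplx x 0) \<le> \<bar>x\<bar>"
  proof (rule modulus_least)
    fix \<theta> :: real
    have "cos \<theta> *\<^sub>R x \<le> \<bar>cos \<theta>\<bar> *\<^sub>R \<bar>x\<bar>"
      using abs_ge_self abs_scaleR_lattice order_trans by blast
    also have "\<dots> \<le> 1 *\<^sub>R \<bar>x\<bar>" by (intro scaleR_right_mono) auto
    finally show "cos \<theta> *\<^sub>R cre (Cplx x 0) + sin \<theta> *\<^sub>R cim (Cplx x 0) \<le> \<bar>x\<bar>" by simp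
  qed
  show "\<bar>x\<bar> \<le> modulus (Cplx x 0)" using abs_cre_le_modulus[of "Cplx x 0"] by simp
qed

lemma modulus_zero: "modulus 0 = 0"
  using modulus_real[of 0] by (simp add: zero_complexification_def)

lemma modulus_add: "modulus (z + w) \<le> modulus z + modulus w"
proof (rule modulus_least)
  fix \<theta> :: real
  show "cos \<theta> *\<^sub>R cre (z + w) + sin \<theta> *\<^sub>R cim (z + w) \<le> modulus z + modulus w"
    using add_mono[OF modulus_upper[of \<theta> z] modulus_upper[of \<theta> w]]
    by (simp add: plus_complexification_def algebra_simps)
qed

lemma modulus_scaleR_le: "modulus (a *\<^sub>R z) \<le> \<bar>a\<bar> *\<^sub>R modulus z"
proof (rule modulus_least)
  fix \<theta> :: real
  have pos: "b *\<^sub>R (cos \<phi> *\<^sub>R cre z + sin \<phi> *\<^sub>R cim z) \<le> b *\<^sub>R modulus z" if "0 \<le> b" for b \<phi>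
    using that by (intro scaleR_left_mono modulus_upper)
  show "cos \<theta> *\<^sub>R cre (a *\<^sub>R z) + sin \<theta> *\<^sub>R cim (a *\<^sub>R z) \<le> \<bar>a\<bar> *\<^sub>R modulus z"
    using pos[of a \<theta>] pos[of "-a" "\<theta> + pi"]
    by (cases "0 \<le> a") (auto simp: scaleR_complexification_def algebra_simps)
qed

instantiation complexification :: (banach_lattice) real_normed_vector
begin

definition norm_complexification_def: "norm (z :: 'a complexification) = norm (modulus z)"
definition sgn_complexification_def: "sgn (z :: 'a complexification) = z /\<^sub>R norm z"
definition dist_complexification_def: "dist (z :: 'a complexification) w = norm (z - w)"
definition uniformity_complexification_def:
  "(uniformity :: ('a complexification \<times> 'a complexification) filter) =
    (INF e\<in>{0<..}. principal {(z, w). dist z w < e})"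
definition open_complexification_def:
  "open (U :: 'a complexification set) \<longleftrightarrow>
    (\<forall>z\<in>U. eventually (\<lambda>(z', w). z' = z \<longrightarrow> w \<in> U) uniformity)"

instance
proof
  have mono: "norm x \<le> norm y" if "0 \<le> x" "x \<le> y" for x y :: 'a
    using that by (intro norm_mono_abs) auto
  fix a :: real and z w :: "'a complexification" and U :: "'a complexification set"
  show "(norm z = 0) = (z = 0)"
  proof
    assume "norm z = 0"
    then have "modulus z = 0" by (simp add: norm_complexification_def)
    then have "\<bar>cre z\<bar> \<le> 0" "\<bar>cim z\<bar> \<le> 0"
      using abs_cre_le_modulus[of z] abs_cim_le_modulus[of z] by simp_all
    then show "z = 0" by (cases z) (simp add: zero_complexification_def)
  qed (simp add: norm_complexification_def modulus_zero)
  show "norm (z + w) \<le> norm z + norm w"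
    unfolding norm_complexification_def
    using mono[OF modulus_nonneg modulus_add] norm_triangle_ineq order_trans by blast
  have le: "norm (b *\<^sub>R v) \<le> \<bar>b\<bar> * norm v" for b and v :: "'a complexification"
    using mono[OF modulus_nonneg modulus_scaleR_le[of b v]]
    by (simp add: norm_complexification_def)
  show "norm (a *\<^sub>R z) = \<bar>a\<bar> * norm z"
  proof (cases "a = 0")
    case False
    then have "norm z \<le> \<bar>inverse a\<bar> * norm (a *\<^sub>R z)"
      using le[of "inverse a" "a *\<^sub>R z"] by simp
    then show ?thesis using le[of a z] False by (simp add: field_simps)
  qed (simp add: norm_complexification_def modulus_zero)
qed (rule sgn_complexification_def dist_complexification_def uniformity_complexification_def
    open_complexification_def)+

end

section \<open>The dual, its order and its weak* topology\<close>

text \<open>\<open>X\<^sup>*\<close> is the set of bounded complex-linear functionals on the complexification; its norm is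
  the operator norm on the type of bounded (real-)linear maps.\<close>

type_synonym 'a functional = "'a complexification \<Rightarrow>\<^sub>L complex"

definition dual :: "'a::banach_lattice functional set"
  where "dual = {f :: 'a functional. \<forall>c z. f (scaleC c z) = c * f z}"

definition dual_pos :: "'a::banach_lattice functional set"
  where "dual_pos = {f \<in> dual. \<forall>x\<ge>0. f (Cplx x 0) \<in> \<real>\<^sub>\<ge>\<^sub>0}"

definition dual_le :: "'a::banach_lattice functional \<Rightarrow> 'a functional \<Rightarrow> bool"
  where "dual_le f g \<longleftrightarrow> g - f \<in> dual_pos"

definition is_dual_Sup :: "(nat \<Rightarrow> 'a::banach_lattice functional) \<Rightarrow> 'a functional \<Rightarrow> bool"
  where "is_dual_Sup F g \<longleftrightarrow> g \<in> dual \<and> (\<forall>n. dual_le (F n) g) \<and>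
    (\<forall>h\<in>dual. (\<forall>n. dual_le (F n) h) \<longrightarrow> dual_le g h)"

definition scaleC_functional :: "complex \<Rightarrow> 'a::banach_lattice functional \<Rightarrow> 'a functional"
  where "scaleC_functional c f = blinfun_mult_right c o\<^sub>L f"

text \<open>For scalar-valued maps the strong operator topology is the topology of pointwise convergence,
  that is, \<open>\<sigma>(X\<^sup>*, X)\<close>.\<close>

definition weak_star :: "'a::banach_lattice functional topology"
  where "weak_star = subtopology strong_operator_topology dual"

section \<open>Operators on the dual\<close>

text \<open>Operators are represented by functions whose values outside \<open>dual\<close> are irrelevant.\<close>

definition dual_operator :: "('a::banach_lattice functional \<Rightarrow> 'a functional) \<Rightarrow> bool"
  where "dual_operator U \<longleftrightarrow> (\<forall>f\<in>dual. U f \<in> dual) \<and>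
    (\<forall>f\<in>dual. \<forall>g\<in>dual. U (f + g) = U f + U g) \<and>
    (\<forall>c. \<forall>f\<in>dual. U (scaleC_functional c f) = scaleC_functional c (U f))"

definition positive_op :: "('a::banach_lattice functional \<Rightarrow> 'a functional) \<Rightarrow> bool"
  where "positive_op U \<longleftrightarrow> (\<forall>f\<in>dual_pos. U f \<in> dual_pos)"

definition op_le ::
  "('a::banach_lattice functional \<Rightarrow> 'a functional) \<Rightarrow> ('a functional \<Rightarrow> 'a functional) \<Rightarrow> bool"
  where "op_le U V \<longleftrightarrow> positive_op (\<lambda>f. V f - U f)"

definition contraction_op :: "('a::banach_lattice functional \<Rightarrow> 'a functional) \<Rightarrow> bool"
  where "contraction_op U \<longleftrightarrow> (\<forall>f\<in>dual. norm (U f) \<le> norm f)"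

definition is_op_Sup ::
  "(nat \<Rightarrow> 'a::banach_lattice functional \<Rightarrow> 'a functional) \<Rightarrow> ('a functional \<Rightarrow> 'a functional) \<Rightarrow> bool"
  where "is_op_Sup U V \<longleftrightarrow> dual_operator V \<and> (\<forall>f\<in>dual_pos. is_dual_Sup (\<lambda>n. U n f) (V f))"

section \<open>*-semigroups and their Laplace transforms\<close>

text \<open>Only the values at \<open>t > 0\<close> matter. Measurability is Lebesgue measurability on
  \<open>(0, \<infinity>)\<close>.\<close>

definition star_semigroup :: "(real \<Rightarrow> 'a::banach_lattice functional \<Rightarrow> 'a functional) \<Rightarrow> bool"
  where "star_semigroup T \<longleftrightarrow>
    (\<forall>t>0. dual_operator (T t) \<and> continuous_map weak_star weak_star (T t)) \<and>
    (\<forall>t>0. \<forall>s>0. \<forall>f\<in>dual. T (t + s) f = T t (T s f)) \<and>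
    (\<forall>f\<in>dual. \<forall>z. (\<lambda>t. T t f z) \<in> borel_measurable (lebesgue_on {0<..}))"

definition positive_semigroup :: "(real \<Rightarrow> 'a::banach_lattice functional \<Rightarrow> 'a functional) \<Rightarrow> bool"
  where "positive_semigroup T \<longleftrightarrow> star_semigroup T \<and> (\<forall>t>0. positive_op (T t))"

definition contractive_semigroup ::
  "(real \<Rightarrow> 'a::banach_lattice functional \<Rightarrow> 'a functional) \<Rightarrow> bool"
  where "contractive_semigroup T \<longleftrightarrow> star_semigroup T \<and> (\<forall>t>0. contraction_op (T t))"

definition is_Laplace_transform ::
  "(real \<Rightarrow> 'a::banach_lattice functional \<Rightarrow> 'a functional) \<Rightarrow>
   (complex \<Rightarrow> 'a functional \<Rightarrow> 'a functional) \<Rightarrow> bool"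
  where "is_Laplace_transform T R \<longleftrightarrow>
    (\<forall>\<mu>. Re \<mu> > 0 \<longrightarrow> dual_operator (R \<mu>) \<and>
      (\<forall>f\<in>dual. \<forall>z. integrable (lebesgue_on {0<..}) (\<lambda>t. exp (- \<mu> * of_real t) * T t f z) \<and>
        R \<mu> f z = integral\<^sup>L (lebesgue_on {0<..}) (\<lambda>t. exp (- \<mu> * of_real t) * T t f z)))"

end

theory Submission
  imports Defs
begin

text \<open>A weak*-continuous operator on the dual is \<open>f \<mapsto> f \<circ> S\<close> for a preadjoint \<open>S\<close>. For an increasing
  sequence of positive contractions the preadjoints increase on the positive cone (a vector on which
  all positive functionals are nonnegative is itself positive, by Hahn--Banach) and are bounded, so
  by the KB property they converge there in norm. Hence the operators converge pointwise, the limit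
  is their supremum, and it has a preadjoint again, i.e. it is weak*-continuous. That any supremum is
  this limit on the whole dual follows because positive functionals span the dual. The semigroup law
  comes from letting \<open>n\<close> and then \<open>m\<close> tend to infinity in \<open>T\<^sub>m(t) T\<^sub>n(s)\<close>, using the weak* continuity of
  \<open>T\<^sub>m(t)\<close>; the Laplace transforms converge by dominated convergence.\<close>

section \<open>A sandwich theorem for sublinear functionals\<close>

definition sublinear :: "('a::real_vector \<Rightarrow> real) \<Rightarrow> bool"
  where "sublinear p \<longleftrightarrow> (\<forall>x y. p (x + y) \<le> p x + p y) \<and> (\<forall>t\<ge>0. \<forall>x. p (t *\<^sub>R x) = t * p x)"

text \<open>One-sided homogeneity suffices: applied with \<open>inverse t\<close> to
  \<open>t *\<^sub>R x\<close> it gives the reverse inequality.\<close>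

lemma sublinearI:
  assumes "\<And>x y. p (x + y) \<le> p x + p y" and hom: "\<And>t x. t > 0 \<Longrightarrow> p (t *\<^sub>R x) \<le> t * p x" and "p 0 = 0"
  shows "sublinear p"
proof -
  have "p (t *\<^sub>R x) = t * p x" if "t \<ge> 0" for t x
  proof (cases "t = 0")
    case False
    then have t: "t > 0" using that by simp
    have "p (inverse t *\<^sub>R (t *\<^sub>R x)) \<le> inverse t * p (t *\<^sub>R x)"
      using t by (intro hom) simp
    then have "t * p x \<le> p (t *\<^sub>R x)"
      using t by (simp add: field_simps)
    with hom[OF t] show ?thesis by (simp add: antisym)
  qed (simp add: assms)
  then show ?thesis using assms(1) by (simp add: sublinear_def)
qed

lemma sublinear_add: "sublinear p \<Longrightarrow> p (x + y) \<le> p x + p y"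
  by (simp add: sublinear_def)

lemma sublinear_scaleR: "sublinear p \<Longrightarrow> t \<ge> 0 \<Longrightarrow> p (t *\<^sub>R x) = t * p x"
  by (simp add: sublinear_def)

lemma sublinear_zero: "sublinear p \<Longrightarrow> p 0 = 0"
  using sublinear_scaleR[of p 0 0] by simp

lemma sublinear_minus: "sublinear p \<Longrightarrow> - p (- x) \<le> p x"
  using sublinear_add[of p x "- x"] by (simp add: sublinear_zero)

text \<open>The gauge \<open>x \<mapsto> inf {p (x + a) - \<psi> a | a \<in> C}\<close>: every linear functional below it is below
  \<open>p\<close> and, by taking \<open>x = - a\<close>, above \<open>\<psi>\<close> on \<open>C\<close>.\<close>

lemma sublinear_inf:
  fixes p \<psi> :: "'a::real_vector \<Rightarrow> real"
  assumes p: "sublinear p"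
    and C: "0 \<in> C" "\<And>a b. a \<in> C \<Longrightarrow> b \<in> C \<Longrightarrow> a + b \<in> C" "\<And>t a. t > 0 \<Longrightarrow> a \<in> C \<Longrightarrow> t *\<^sub>R a \<in> C"
    and \<psi>: "\<And>a b. a \<in> C \<Longrightarrow> b \<in> C \<Longrightarrow> \<psi> a + \<psi> b \<le> \<psi> (a + b)"
      "\<And>t a. t > 0 \<Longrightarrow> a \<in> C \<Longrightarrow> \<psi> (t *\<^sub>R a) = t * \<psi> a" "\<psi> 0 = 0"
    and le: "\<And>a. a \<in> C \<Longrightarrow> \<psi> a \<le> p a"
  obtains q where "sublinear q" "\<And>x a. a \<in> C \<Longrightarrow> q x \<le> p (x + a) - \<psi> a"
proof
  define q where "q x = (INF a\<in>C. p (x + a) - \<psi> a)" for x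
  \<comment> \<open>Subadditivity at \<open>a = (x + a) + (- x)\<close> and
    \<open>\<psi> \<le> p\<close> on \<open>C\<close> keep the infimum finite.\<close>
  have lower: "- p (- x) \<le> p (x + a) - \<psi> a" if "a \<in> C" for x a
    using sublinear_add[OF p, of "x + a" "- x"] le[OF that] by simp
  then have bdd: "bdd_below ((\<lambda>a. p (x + a) - \<psi> a) ` C)" for x
    by (intro bdd_belowI2)
  show upper: "q x \<le> p (x + a) - \<psi> a" if "a \<in> C" for x a
    unfolding q_def using bdd that by (rule cINF_lower)
  have greatest: "u \<le> q x" if "\<And>a. a \<in> C \<Longrightarrow> u \<le> p (x + a) - \<psi> a" for u x
    unfolding q_def using C(1) that by (intro cINF_greatest) auto
  show "sublinear q"
  proof (rule sublinearI)
    fix x y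
    \<comment> \<open>The point \<open>a + b\<close> of \<open>C\<close> competes for
      \<open>x + y\<close>; superadditivity of \<open>\<psi>\<close> separates the terms. The
      infimum is taken over \<open>a\<close> with \<open>b\<close> fixed, then over
      \<open>b\<close>.\<close>
    have "q (x + y) \<le> (p (x + a) - \<psi> a) + (p (y + b) - \<psi> b)" if "a \<in> C" "b \<in> C" for a b
      using upper[OF C(2)[OF that], of "x + y"] \<psi>(1)[OF that] sublinear_add[OF p, of "x + a" "y + b"]
      by (simp add: algebra_simps)
    then have "q (x + y) - (p (y + b) - \<psi> b) \<le> q x" if "b \<in> C" for b
      using that by (intro greatest) (simp add: algebra_simps)
    then have "q (x + y) - q x \<le> q y"
      by (intro greatest) (simp add: algebra_simps)
    then show "q (x + y) \<le> q x + q y" by simp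
  next
    fix t :: real and x assume t: "t > 0"
    have "q (t *\<^sub>R x) / t \<le> p (x + a) - \<psi> a" if "a \<in> C" for a
      using upper[OF C(3)[OF t that], of "t *\<^sub>R x"] \<psi>(2)[OF t that] sublinear_scaleR[OF p, of t "x + a"] t
      by (simp add: field_simps)
    then have "q (t *\<^sub>R x) / t \<le> q x" by (rule greatest)
    then show "q (t *\<^sub>R x) \<le> t * q x" using t by (simp add: field_simps)
  next
    have "0 \<le> q 0" using le by (intro greatest) simp
    moreover have "q 0 \<le> 0" using upper[OF C(1), of 0] \<psi>(3) sublinear_zero[OF p] by simp
    ultimately show "q 0 = 0" by simp
  qed
qed

text \<open>On a single ray a sublinear functional is additive, so it can itself play the role of
  \<open>\<psi>\<close> in \<open>sublinear_inf\<close> and \<open>sandwich\<close>; the other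
  clauses provide their cone conditions and the point \<open>y\<close>.\<close>

lemma ray_cone:
  fixes y :: "'a::real_vector"
  defines "C \<equiv> (\<lambda>t. t *\<^sub>R y) ` {0..}"
  shows "0 \<in> C" "y \<in> C" "a \<in> C \<Longrightarrow> b \<in> C \<Longrightarrow> a + b \<in> C" "t > 0 \<Longrightarrow> a \<in> C \<Longrightarrow> t *\<^sub>R a \<in> C"
    "sublinear p \<Longrightarrow> a \<in> C \<Longrightarrow> b \<in> C \<Longrightarrow> p a + p b \<le> p (a + b)"
proof -
  show "0 \<in> C" unfolding C_def by (rule image_eqI[of _ _ 0]) auto
  show "y \<in> C" unfolding C_def by (rule image_eqI[of _ _ 1]) auto
  show "t > 0 \<Longrightarrow> a \<in> C \<Longrightarrow> t *\<^sub>R a \<in> C" by (auto simp: C_def)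
  assume "a \<in> C" "b \<in> C"
  then obtain s t where st: "a = s *\<^sub>R y" "b = t *\<^sub>R y" "s \<ge> 0" "t \<ge> 0"
    by (auto simp: C_def)
  then have ab: "a + b = (s + t) *\<^sub>R y" by (simp add: algebra_simps)
  then show "a + b \<in> C" using st by (auto simp: C_def)
  assume p: "sublinear p"
  have "p (a + b) = (s + t) * p y" unfolding ab using st by (simp add: sublinear_scaleR[OF p])
  then show "p a + p b \<le> p (a + b)" using st by (simp add: sublinear_scaleR[OF p] algebra_simps)
qed

text \<open>Zorn's lemma downwards: the pointwise infimum of a chain is again sublinear, because of
  any two members the smaller one serves both.\<close>

lemma minimal_sublinear:
  fixes p :: "'a::real_vector \<Rightarrow> real"
  assumes p: "sublinear p"
  obtains q where "sublinear q" "q \<le> p" "\<And>r. sublinear r \<Longrightarrow> r \<le> q \<Longrightarrow> r = q"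
proof -
  define A where "A = {q. sublinear q \<and> q \<le> p}"
  have "\<exists>m\<in>A. \<forall>q\<in>A. m \<ge> q \<longrightarrow> q = m"
  proof (rule predicate_Zorn)
    \<comment> \<open>\<open>predicate_Zorn\<close> yields maximal elements, so it is used with the
      reversed order.\<close>
    show "partial_order_on A (relation_of (\<ge>) A)"
      by (rule partial_order_on_relation_ofI) auto
  next
    fix C assume "C \<in> Chains (relation_of (\<ge>) A)"
    then have CA: "C \<subseteq> A" and tot: "\<And>q r. q \<in> C \<Longrightarrow> r \<in> C \<Longrightarrow> q \<le> r \<or> r \<le> q"
      by (auto simp: Chains_def relation_of_def)
    show "\<exists>u\<in>A. \<forall>q\<in>C. u \<le> q"
    proof (cases "C = {}")
      case True
      then show ?thesis using p by (auto simp: A_def)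
    next
      case False
      define u where "u x = (INF q\<in>C. q x)" for x
      have C: "sublinear q" "q x \<le> p x" if "q \<in> C" for q x
        using CA that by (auto simp: A_def le_fun_def)
      \<comment> \<open>\<open>q x \<ge> - q (- x) \<ge> - p (- x)\<close> bounds all members of the
        chain at once.\<close>
      have "- p (- x) \<le> q x" if "q \<in> C" for q x
        using C[OF that] sublinear_minus[of q x] by (smt (verit))
      then have bdd: "bdd_below ((\<lambda>q. q x) ` C)" for x
        by (intro bdd_belowI2)
      have upper: "u x \<le> q x" if "q \<in> C" for q x
        unfolding u_def using bdd that by (rule cINF_lower)
      have greatest: "v \<le> u x" if "\<And>q. q \<in> C \<Longrightarrow> v \<le> q x" for v x
        unfolding u_def using False that by (intro cINF_greatest)
      have "sublinear u"
      proof (rule sublinearI)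
        fix x y
        have "u (x + y) \<le> q x + r y" if qr: "q \<in> C" "r \<in> C" for q r
        proof -
          obtain s where s: "s \<in> C" "s \<le> q" "s \<le> r" using tot[OF qr] qr by blast
          then show ?thesis
            using upper[OF s(1), of "x + y"] sublinear_add[OF C(1)[OF s(1)], of x y]
            by (smt (verit) le_fun_def)
        qed
        then have "u (x + y) - r y \<le> u x" if "r \<in> C" for r
          using that by (intro greatest) (simp add: algebra_simps)
        then have "u (x + y) - u x \<le> u y"
          by (intro greatest) (simp add: algebra_simps)
        then show "u (x + y) \<le> u x + u y" by simp
      next
        fix t :: real and x assume t: "t > 0"
        have "u (t *\<^sub>R x) / t \<le> q x" if "q \<in> C" for q
          using upper[OF that, of "t *\<^sub>R x"] sublinear_scaleR[OF C(1)[OF that], of t x] t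
          by (simp add: field_simps)
        then have "u (t *\<^sub>R x) / t \<le> u x" by (rule greatest)
        then show "u (t *\<^sub>R x) \<le> t * u x" using t by (simp add: field_simps)
      next
        have "(\<lambda>q. q 0) ` C = {0}" using False C(1) sublinear_zero by force
        then show "u 0 = 0" by (simp add: u_def)
      qed
      moreover have "u \<le> p" using upper C False by (meson all_not_in_conv le_funI order_trans)
      ultimately show ?thesis using upper by (auto simp: A_def le_fun_def)
    qed
  qed
  then show ?thesis using that unfolding A_def by (metis (mono_tags, lifting) mem_Collect_eq order_trans)
qed

text \<open>Instead of extending a functional one dimension at a time, the proof shows that a
  minimal sublinear functional is linear.\<close>

lemma Hahn_Banach_sublinear:
  fixes p :: "'a::real_vector \<Rightarrow> real"
  assumes p: "sublinear p"
  obtains f where "linear f" "\<And>x. f x \<le> p x"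
proof -
  obtain q where q: "sublinear q" "q \<le> p" and min: "\<And>r. sublinear r \<Longrightarrow> r \<le> q \<Longrightarrow> r = q"
    using minimal_sublinear[OF p] by blast
  \<comment> \<open>\<open>sublinear_inf\<close> on the ray through \<open>y\<close>, with \<open>\<psi> = q\<close>, cannot decrease the minimal \<open>q\<close>;
    this makes \<open>q\<close> superadditive.\<close>
  have ge: "q x + q y \<le> q (x + y)" for x y
  proof -
    define C where "C = (\<lambda>t. t *\<^sub>R y) ` {0..}"
    note C = ray_cone[where y = y, folded C_def]
    obtain r where r: "sublinear r" "\<And>x a. a \<in> C \<Longrightarrow> r x \<le> q (x + a) - q a"
      by (rule sublinear_inf[OF q(1) C(1) C(3) C(4) C(5)[OF q(1)]])
        (auto simp: sublinear_scaleR[OF q(1)] sublinear_zero[OF q(1)])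
    have "r \<le> q" using r(2)[OF C(1)] sublinear_zero[OF q(1)] by (simp add: le_fun_def)
    then have "r = q" by (rule min[OF r(1)])
    then show ?thesis using r(2)[OF C(2), of x] by simp
  qed
  have add: "q (x + y) = q x + q y" for x y
    using ge[of x y] sublinear_add[OF q(1), of x y] by simp
  then have minus: "q (- x) = - q x" for x
    using add[of x "- x"] sublinear_zero[OF q(1)] by simp
  have "q (t *\<^sub>R x) = t * q x" for t x
    using sublinear_scaleR[OF q(1), of t x] sublinear_scaleR[OF q(1), of "- t" x] minus[of "t *\<^sub>R x"]
    by (cases "t \<ge> 0") auto
  then have "linear q" using add by (intro linearI) auto
  then show ?thesis using that q(2) by (auto simp: le_fun_def)
qed

text \<open>Hahn--Banach below the gauge from \<open>sublinear_inf\<close>. With \<open>C\<close> a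
  ray it gives norming functionals, with \<open>C\<close> the positive cone positive
  majorants.\<close>

lemma sandwich:
  fixes p \<psi> :: "'a::real_vector \<Rightarrow> real"
  assumes p: "sublinear p"
    and C: "0 \<in> C" "\<And>a b. a \<in> C \<Longrightarrow> b \<in> C \<Longrightarrow> a + b \<in> C" "\<And>t a. t > 0 \<Longrightarrow> a \<in> C \<Longrightarrow> t *\<^sub>R a \<in> C"
    and \<psi>: "\<And>a b. a \<in> C \<Longrightarrow> b \<in> C \<Longrightarrow> \<psi> a + \<psi> b \<le> \<psi> (a + b)"
      "\<And>t a. t > 0 \<Longrightarrow> a \<in> C \<Longrightarrow> \<psi> (t *\<^sub>R a) = t * \<psi> a" "\<psi> 0 = 0"
    and le: "\<And>a. a \<in> C \<Longrightarrow> \<psi> a \<le> p a"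
  obtains f where "linear f" "\<And>x. f x \<le> p x" "\<And>a. a \<in> C \<Longrightarrow> \<psi> a \<le> f a"
proof -
  obtain q where q: "sublinear q" "\<And>x a. a \<in> C \<Longrightarrow> q x \<le> p (x + a) - \<psi> a"
    by (rule sublinear_inf[OF assms]) blast+
  obtain f where f: "linear f" "\<And>x. f x \<le> q x"
    using Hahn_Banach_sublinear[OF q(1)] by blast
  have "f x \<le> p x" for x
    using f(2)[of x] q(2)[OF C(1), of x] \<psi>(3) by simp
  moreover have "\<psi> a \<le> f a" if "a \<in> C" for a
    using f(2)[of "- a"] q(2)[OF that, of "- a"] sublinear_zero[OF p] linear_neg[OF f(1), of a] by simp
  ultimately show ?thesis using that f(1) by blast
qed

section \<open>Positive functionals\<close>

lemma norm_mono_nonneg: "0 \<le> x \<Longrightarrow> x \<le> y \<Longrightarrow> norm x \<le> norm (y::'a::banach_lattice)"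
  by (intro norm_mono_abs) auto

text \<open>This gauge replaces the norm as dominating functional, because linear functionals below
  it are bounded and also positive. It is sublinear since the positive part is subadditive and the
  norm monotone.\<close>

lemma sublinear_norm_pos_part:
  assumes "K \<ge> 0"
  shows "sublinear (\<lambda>x::'a::banach_lattice. K * norm (sup x 0))"
proof (rule sublinearI)
  fix x y :: 'a
  have "sup (x + y) 0 \<le> sup x 0 + sup y 0"
    by (intro sup_least add_mono add_nonneg_nonneg) auto
  then have "norm (sup (x + y) 0) \<le> norm (sup x 0 + sup y 0)"
    by (intro norm_mono_nonneg) auto
  also have "\<dots> \<le> norm (sup x 0) + norm (sup y 0)" by (rule norm_triangle_ineq)
  finally show "K * norm (sup (x + y) 0) \<le> K * norm (sup x 0) + K * norm (sup y 0)"
    using assms by (metis mult_left_mono distrib_left)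
next
  fix t :: real and x :: 'a assume t: "t > 0"
  have "sup (t *\<^sub>R x) 0 \<le> t *\<^sub>R sup x 0"
    using t by (intro sup_least scaleR_left_mono scaleR_nonneg_nonneg) auto
  then have "norm (sup (t *\<^sub>R x) 0) \<le> norm (t *\<^sub>R sup x 0)" by (intro norm_mono_nonneg) auto
  then have "K * norm (sup (t *\<^sub>R x) 0) \<le> K * (t * norm (sup x 0))"
    using t assms by (intro mult_left_mono) auto
  then show "K * norm (sup (t *\<^sub>R x) 0) \<le> t * (K * norm (sup x 0))" by (simp add: ac_simps)
qed simp

lemma norm_pos_part_le: "norm (sup x 0) \<le> norm (x::'a::banach_lattice)"
proof -
  have "norm (sup x 0) \<le> norm \<bar>x\<bar>" by (intro norm_mono_nonneg) (auto simp: abs_ge_self)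
  then show ?thesis by simp
qed

text \<open>Positivity comes from the gauge vanishing at \<open>- x\<close> for
  \<open>x \<ge> 0\<close>, boundedness from \<open>norm_pos_part_le\<close>.\<close>

lemma dominated_linear_functional:
  fixes g :: "'a::banach_lattice \<Rightarrow> real"
  assumes g: "linear g" and le: "\<And>x. g x \<le> K * norm (sup x 0)" and K: "K \<ge> 0"
  shows "\<bar>g x\<bar> \<le> K * norm x" "0 \<le> x \<Longrightarrow> 0 \<le> g x"
proof -
  have "K * norm (sup y 0) \<le> K * norm y" for y :: 'a
    using K norm_pos_part_le by (intro mult_left_mono)
  then have "g y \<le> K * norm y" for y using le order_trans by blast
  from this[of x] this[of "- x"] show "\<bar>g x\<bar> \<le> K * norm x" by (simp add: linear_neg[OF g])
  assume "0 \<le> x"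
  then have "sup (- x) 0 = 0" by (simp add: sup_absorb2)
  then show "0 \<le> g x" using le[of "- x"] by (simp add: linear_neg[OF g])
qed

text \<open>\<open>sandwich\<close> on the ray through \<open>y\<close>, with the gauge serving both
  as upper bound and as \<open>\<psi>\<close>.\<close>

lemma norming_positive_functional:
  fixes y :: "'a::banach_lattice"
  obtains g where "linear g" "\<And>x. \<bar>g x\<bar> \<le> norm x" "\<And>x. 0 \<le> x \<Longrightarrow> 0 \<le> g x" "norm (sup y 0) \<le> g y"
proof -
  define p where "p x = 1 * norm (sup x 0)" for x :: 'a
  have p: "sublinear p" unfolding p_def by (rule sublinear_norm_pos_part) simp
  define C where "C = (\<lambda>t. t *\<^sub>R y) ` {0..}"
  note C = ray_cone[where y = y, folded C_def]
  obtain g where g: "linear g" "\<And>x. g x \<le> p x" "\<And>a. a \<in> C \<Longrightarrow> p a \<le> g a"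
    by (rule sandwich[OF p C(1) C(3) C(4) C(5)[OF p]]) (auto simp: sublinear_scaleR[OF p] sublinear_zero[OF p])
  have "norm (sup y 0) \<le> g y" using g(3)[OF C(2)] by (simp add: p_def)
  then show ?thesis
    using that[OF g(1)] dominated_linear_functional[OF g(1), of 1] g(2) by (simp add: p_def)
qed

text \<open>\<open>sandwich\<close> over the positive cone, where the gauge is \<open>K\<close>
  times the norm and hence dominates \<open>\<phi>\<close>.\<close>

lemma positive_majorant:
  fixes \<phi> :: "'a::banach_lattice \<Rightarrow> real"
  assumes \<phi>: "linear \<phi>" and bound: "\<And>x. \<bar>\<phi> x\<bar> \<le> K * norm x" and K: "K \<ge> 0"
  obtains g where "linear g" "\<And>x. \<bar>g x\<bar> \<le> K * norm x" "\<And>x. 0 \<le> x \<Longrightarrow> 0 \<le> g x"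
    "\<And>x. 0 \<le> x \<Longrightarrow> \<phi> x \<le> g x"
proof -
  have "\<phi> a \<le> K * norm (sup a 0)" if "0 \<le> a" for a
    using bound[of a] that by (simp add: sup_absorb1)
  then obtain g where g: "linear g" "\<And>x. g x \<le> K * norm (sup x 0)" "\<And>a. a \<in> {0..} \<Longrightarrow> \<phi> a \<le> g a"
    using linear_add[OF \<phi>] linear_scale[OF \<phi>] linear_0[OF \<phi>]
    by (rule_tac sandwich[OF sublinear_norm_pos_part[OF K], of "{0..}" \<phi>])
      (auto intro!: scaleR_nonneg_nonneg)
  then show ?thesis using that[OF g(1)] dominated_linear_functional[OF g(1,2) K] by simp
qed


section \<open>Complex functionals and their values on real vectors\<close>

lemma Cplx_linear:
  "Cplx (x + y) 0 = Cplx x 0 + Cplx y 0" "Cplx (x - y) 0 = Cplx x 0 - Cplx y 0"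
  "Cplx (t *\<^sub>R x) 0 = t *\<^sub>R Cplx x 0" "Cplx 0 0 = 0"
  by (simp_all add: plus_complexification_def minus_complexification_def scaleR_complexification_def
      zero_complexification_def)

lemma norm_Cplx_real [simp]: "norm (Cplx x 0) = norm (x::'a::banach_lattice)"
  by (simp add: norm_complexification_def modulus_real)

lemma norm_cre_le: "norm (cre z) \<le> norm (z::'a::banach_lattice complexification)"
  using norm_mono_nonneg[OF _ abs_cre_le_modulus[of z]] by (simp add: norm_complexification_def)

lemma norm_cim_le: "norm (cim z) \<le> norm (z::'a::banach_lattice complexification)"
  using norm_mono_nonneg[OF _ abs_cim_le_modulus[of z]] by (simp add: norm_complexification_def)

lemma scaleC_functional_apply [simp]: "scaleC_functional c f z = c * f z"
  by (simp add: scaleC_functional_def)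

lemma dual_scaleC: "f \<in> dual \<Longrightarrow> f (scaleC c z) = c * f z"
  by (simp add: dual_def)

lemma dual_closed:
  "0 \<in> dual" "f \<in> dual \<Longrightarrow> g \<in> dual \<Longrightarrow> f + g \<in> dual" "f \<in> dual \<Longrightarrow> g \<in> dual \<Longrightarrow> f - g \<in> dual"
  "f \<in> dual \<Longrightarrow> scaleC_functional c f \<in> dual"
  by (auto simp: dual_def blinfun.add_left blinfun.diff_left algebra_simps)

lemma dual_posD:
  assumes "f \<in> dual_pos"
  shows "f \<in> dual" "0 \<le> x \<Longrightarrow> f (Cplx x 0) \<in> \<real>\<^sub>\<ge>\<^sub>0"
    "0 \<le> x \<Longrightarrow> 0 \<le> Re (f (Cplx x 0))" "0 \<le> x \<Longrightarrow> Im (f (Cplx x 0)) = 0"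
  using assms by (auto simp: dual_pos_def complex_nonneg_Reals_iff)

lemma dual_pos_add: "f \<in> dual_pos \<Longrightarrow> g \<in> dual_pos \<Longrightarrow> f + g \<in> dual_pos"
  by (auto simp: dual_pos_def dual_closed blinfun.add_left nonneg_Reals_add_I)

lemma functional_eq_real_parts:
  assumes "f \<in> dual"
  shows "f z = f (Cplx (cre z) 0) + \<i> * f (Cplx (cim z) 0)"
proof -
  have "z = Cplx (cre z) 0 + scaleC \<i> (Cplx (cim z) 0)"
    by (cases z) (simp add: plus_complexification_def scaleC_def)
  then have "f z = f (Cplx (cre z) 0 + scaleC \<i> (Cplx (cim z) 0))" by simp
  then show ?thesis using assms by (simp add: blinfun.add_right dual_scaleC)
qed

text \<open>Both \<open>\<bar>x\<bar>\<close> and \<open>\<bar>x\<bar> - x\<close> are nonnegative,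
  so what is known on the positive cone carries over to all real vectors.\<close>

lemma functional_eq_pos_parts: "f (Cplx x 0) = f (Cplx \<bar>x\<bar> 0) - f (Cplx (\<bar>x\<bar> - x) 0)"
  for f :: "'a::banach_lattice functional"
  by (simp add: Cplx_linear blinfun.diff_right)

lemma abs_diff_self_nonneg: "0 \<le> \<bar>x\<bar> - (x::'a::banach_lattice)"
  by (simp add: abs_ge_self)

lemma dual_eqI:
  fixes f g :: "'a::banach_lattice functional"
  assumes "f \<in> dual" "g \<in> dual" and eq: "\<And>x. 0 \<le> x \<Longrightarrow> f (Cplx x 0) = g (Cplx x 0)"
  shows "f = g"
proof (rule blinfun_eqI)
  have "f (Cplx x 0) = g (Cplx x 0)" for x
    using eq[of "\<bar>x\<bar>"] eq[OF abs_diff_self_nonneg, of x]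
    by (subst (1 2) functional_eq_pos_parts) simp
  then show "f z = g z" for z
    using assms by (subst (1 2) functional_eq_real_parts) auto
qed

text \<open>The complex-linear extension of a real functional. \<open>Blinfun\<close> has the
  intended values only for bounded linear maps, hence the bound \<open>K\<close> carried by the
  facts about it.\<close>

definition complexify :: "('a::banach_lattice \<Rightarrow> real) \<Rightarrow> 'a functional"
  where "complexify g = Blinfun (\<lambda>z. Complex (g (cre z)) (g (cim z)))"

text \<open>The factor 2 comes from adding the bounds for the real and the imaginary part.\<close>

lemma complexify:
  fixes g :: "'a::banach_lattice \<Rightarrow> real"
  assumes g: "linear g" and bound: "\<And>x. \<bar>g x\<bar> \<le> K * norm x" and K: "K \<ge> 0"
  shows complexify_apply: "complexify g z = Complex (g (cre z)) (g (cim z))"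
    and complexify_in_dual: "complexify g \<in> dual"
    and norm_complexify: "norm (complexify g) \<le> 2 * K"
proof -
  have norm: "norm (Complex (g (cre z)) (g (cim z))) \<le> 2 * K * norm z" for z
  proof -
    have "norm (Complex (g (cre z)) (g (cim z))) \<le> \<bar>g (cre z)\<bar> + \<bar>g (cim z)\<bar>"
      using cmod_le[of "Complex (g (cre z)) (g (cim z))"] by simp
    also have "\<dots> \<le> K * norm (cre z) + K * norm (cim z)" by (intro add_mono bound)
    also have "\<dots> \<le> K * norm z + K * norm z"
      using K by (intro add_mono mult_left_mono norm_cre_le norm_cim_le)
    finally show ?thesis by simp
  qed
  have "bounded_linear (\<lambda>z. Complex (g (cre z)) (g (cim z)))"
  proof (rule bounded_linear_intro)
    show "norm (Complex (g (cre z)) (g (cim z))) \<le> norm z * (2 * K)" for z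
      using norm[of z] by (simp add: ac_simps)
  qed (auto simp: plus_complexification_def scaleR_complexification_def linear_add[OF g]
        linear_scale[OF g] complex_eq_iff)
  then show ap: "complexify g z = Complex (g (cre z)) (g (cim z))" for z
    by (simp add: complexify_def bounded_linear_Blinfun_apply)
  show "complexify g \<in> dual"
    by (auto simp: dual_def ap scaleC_def complex_eq_iff linear_add[OF g] linear_diff[OF g]
        linear_scale[OF g] algebra_simps)
  show "norm (complexify g) \<le> 2 * K"
    using norm K by (intro norm_blinfun_bound) (auto simp: ap)
qed

lemma complexify_pos:
  fixes g :: "'a::banach_lattice \<Rightarrow> real"
  assumes g: "linear g" and bound: "\<And>x. \<bar>g x\<bar> \<le> K * norm x" and K: "K \<ge> 0"
    and pos: "\<And>x. 0 \<le> x \<Longrightarrow> 0 \<le> g x"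
  shows "complexify g \<in> dual_pos"
  using complexify_in_dual[OF g bound K] pos
  by (auto simp: dual_pos_def complexify_apply[OF g bound K] complex_nonneg_Reals_iff linear_0[OF g])

text \<open>Hahn--Banach separation from the positive cone: a norming positive functional for the
  positive part of \<open>- cre w\<close>, \<open>cim w\<close> or \<open>- cim w\<close> is
  nonpositive at that vector by hypothesis, so all three positive parts vanish.\<close>

lemma nonneg_by_functionals:
  fixes w :: "'a::banach_lattice complexification"
  assumes w: "\<And>f. f \<in> dual_pos \<Longrightarrow> f w \<in> \<real>\<^sub>\<ge>\<^sub>0"
  shows "w = Cplx (cre w) 0" "0 \<le> cre w"
proof -
  have key: "norm (sup y 0) \<le> 0" if y: "y = - cre w \<or> y = cim w \<or> y = - cim w" for y
  proof -
    obtain g where g: "linear g" "\<And>x. \<bar>g x\<bar> \<le> norm x" "\<And>x. 0 \<le> x \<Longrightarrow> 0 \<le> g x" "norm (sup y 0) \<le> g y"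
      using norming_positive_functional[of y] by blast
    have bound: "\<bar>g x\<bar> \<le> 1 * norm x" for x using g(2) by simp
    have "Complex (g (cre w)) (g (cim w)) \<in> \<real>\<^sub>\<ge>\<^sub>0"
      using w[OF complexify_pos[OF g(1) bound _ g(3)]] complexify_apply[OF g(1) bound] by simp
    then have "0 \<le> g (cre w)" "g (cim w) = 0" by (auto simp: complex_nonneg_Reals_iff)
    then have "g y \<le> 0" using y by (auto simp: linear_neg[OF g(1)])
    then show ?thesis using g(4) by linarith
  qed
  then have "sup (- cre w) 0 = 0" "sup (cim w) 0 = 0" "sup (- cim w) 0 = 0" by auto
  then have "- cre w \<le> 0" "cim w \<le> 0" "- cim w \<le> 0" by (metis sup_ge1)+
  then show "0 \<le> cre w" "w = Cplx (cre w) 0" by (auto intro: complexification.expand)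
qed

text \<open>The 2 is that of \<open>norm_complexify\<close>. The lemma serves to bound the
  preadjoint vectors in \<open>converges_on_positive\<close>.\<close>

lemma dual_pos_norming:
  fixes s :: "'a::banach_lattice"
  assumes "0 \<le> s"
  obtains f where "f \<in> dual_pos" "norm f \<le> 2" "norm s \<le> Re (f (Cplx s 0))"
proof -
  obtain g where g: "linear g" "\<And>x. \<bar>g x\<bar> \<le> norm x" "\<And>x. 0 \<le> x \<Longrightarrow> 0 \<le> g x" "norm (sup s 0) \<le> g s"
    using norming_positive_functional[of s] by blast
  have bound: "\<bar>g x\<bar> \<le> 1 * norm x" for x using g(2) by simp
  show ?thesis
    using that[OF complexify_pos[OF g(1) bound _ g(3)]] norm_complexify[OF g(1) bound] g(4) assms
    by (simp add: complexify_apply[OF g(1) bound] sup_absorb1)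
qed

text \<open>A positive majorant \<open>g\<close> gives \<open>\<phi> = g - (g - \<phi>)\<close> with
  both terms positive.\<close>

lemma real_functional_difference:
  fixes \<phi> :: "'a::banach_lattice \<Rightarrow> real"
  assumes \<phi>: "linear \<phi>" and bound: "\<And>x. \<bar>\<phi> x\<bar> \<le> K * norm x" and K: "K \<ge> 0"
  obtains p q where "p \<in> dual_pos" "q \<in> dual_pos" "\<And>x. p (Cplx x 0) - q (Cplx x 0) = of_real (\<phi> x)"
proof -
  obtain g where g: "linear g" "\<And>x. \<bar>g x\<bar> \<le> K * norm x" "\<And>x. 0 \<le> x \<Longrightarrow> 0 \<le> g x"
      "\<And>x. 0 \<le> x \<Longrightarrow> \<phi> x \<le> g x"
    using positive_majorant[OF \<phi> bound K] by blast
  have h: "linear (\<lambda>x. g x - \<phi> x)" using g(1) \<phi> by (rule linear_compose_sub)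
  have h_bound: "\<bar>g x - \<phi> x\<bar> \<le> (2 * K) * norm x" for x
    using g(2)[of x] bound[of x] by linarith
  show ?thesis
  proof (rule that)
    show "complexify g \<in> dual_pos" using g K by (intro complexify_pos)
    show "complexify (\<lambda>x. g x - \<phi> x) \<in> dual_pos"
      using K g(4) by (intro complexify_pos[OF h h_bound]) auto
    show "complexify g (Cplx x 0) - complexify (\<lambda>x. g x - \<phi> x) (Cplx x 0) = of_real (\<phi> x)" for x
      using K by (simp add: complexify_apply[OF g(1,2)] complexify_apply[OF h h_bound] complex_eq_iff
          linear_0[OF g(1)] linear_0[OF \<phi>])
  qed
qed

text \<open>The real and imaginary parts of \<open>f\<close> on real vectors are split separately.
  Differences are written with \<open>scaleC_functional (-1)\<close> because
  \<open>dual_operator\<close> speaks of sums and complex multiples.\<close>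

lemma dual_decomposition:
  fixes f :: "'a::banach_lattice functional"
  assumes f: "f \<in> dual"
  obtains p q r s where "p \<in> dual_pos" "q \<in> dual_pos" "r \<in> dual_pos" "s \<in> dual_pos"
    "f = (p + scaleC_functional (-1) q) + scaleC_functional \<i> (r + scaleC_functional (-1) s)"
proof -
  have bound: "\<bar>Re (f (Cplx x 0))\<bar> \<le> norm f * norm x" "\<bar>Im (f (Cplx x 0))\<bar> \<le> norm f * norm x" for x
    using norm_blinfun[of f "Cplx x 0"]
    by (auto intro: order_trans[OF abs_Re_le_cmod] order_trans[OF abs_Im_le_cmod])
  have lin: "linear (\<lambda>x. Re (f (Cplx x 0)))" "linear (\<lambda>x. Im (f (Cplx x 0)))"
    by (auto intro!: linearI simp: Cplx_linear blinfun.add_right blinfun.scaleR_right)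
  obtain p q where pq: "p \<in> dual_pos" "q \<in> dual_pos"
      "\<And>x. p (Cplx x 0) - q (Cplx x 0) = of_real (Re (f (Cplx x 0)))"
    using real_functional_difference[OF lin(1) bound(1)] by auto
  obtain r s where rs: "r \<in> dual_pos" "s \<in> dual_pos"
      "\<And>x. r (Cplx x 0) - s (Cplx x 0) = of_real (Im (f (Cplx x 0)))"
    using real_functional_difference[OF lin(2) bound(2)] by auto
  have "f = (p + scaleC_functional (-1) q) + scaleC_functional \<i> (r + scaleC_functional (-1) s)"
  proof (rule dual_eqI[OF f])
    show "f (Cplx x 0) = ((p + scaleC_functional (-1) q) +
        scaleC_functional \<i> (r + scaleC_functional (-1) s)) (Cplx x 0)" for x
      using pq(3)[of x] rs(3)[of x] complex_eq[of "f (Cplx x 0)"]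
      by (simp add: blinfun.add_left)
  qed (intro dual_closed dual_posD(1) pq rs)
  then show ?thesis using that pq rs by blast
qed

text \<open>\<open>is_op_Sup\<close> prescribes suprema on \<open>dual_pos\<close> only; since
  \<open>dual_pos\<close> spans \<open>dual\<close>, this determines the operator.\<close>

lemma dual_operator_eqI:
  assumes U: "dual_operator U" and V: "dual_operator V"
    and eq: "\<And>f. f \<in> dual_pos \<Longrightarrow> U f = V f" and f: "f \<in> dual"
  shows "U f = V f"
proof -
  obtain p q r s where pos: "p \<in> dual_pos" "q \<in> dual_pos" "r \<in> dual_pos" "s \<in> dual_pos"
    and f: "f = (p + scaleC_functional (-1) q) + scaleC_functional \<i> (r + scaleC_functional (-1) s)"
    using dual_decomposition[OF f] by blast
  show ?thesis
    using U V pos unfolding f dual_operator_def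
    by (simp add: eq dual_closed dual_posD)
qed


section \<open>Weak*-continuous operators and their preadjoints\<close>

text \<open>The algebraic fact that a functional vanishing on the common kernel of finitely many
  evaluations is a combination of them, which is again an evaluation. Induction removes one point of
  \<open>K\<close> at a time.\<close>

lemma functional_of_finite_kernel:
  fixes \<phi> :: "'a::banach_lattice functional \<Rightarrow> complex"
  assumes "finite K"
    and "\<And>f g. f \<in> dual \<Longrightarrow> g \<in> dual \<Longrightarrow> \<phi> (f + g) = \<phi> f + \<phi> g"
    and "\<And>c f. f \<in> dual \<Longrightarrow> \<phi> (scaleC_functional c f) = c * \<phi> f"
    and "\<And>f. f \<in> dual \<Longrightarrow> (\<And>z. z \<in> K \<Longrightarrow> f z = 0) \<Longrightarrow> \<phi> f = 0"
  shows "\<exists>w. \<forall>f\<in>dual. \<phi> f = f w"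
  using assms
proof (induction K arbitrary: \<phi> rule: finite_induct)
  case empty
  then have "\<forall>f\<in>dual. \<phi> f = f 0" by (simp add: blinfun.zero_right)
  then show ?case by blast
next
  case (insert z K)
  show ?case
  proof (cases "\<forall>f\<in>dual. (\<forall>y\<in>K. f y = 0) \<longrightarrow> f z = 0")
    case True
    \<comment> \<open>Vanishing on \<open>K\<close> already forces vanishing at \<open>z\<close>, so
      the kernel condition holds for \<open>K\<close> alone.\<close>
    show ?thesis
      by (rule insert.IH[OF insert.prems(1,2)]) (use insert.prems(3) True in blast)+
  next
    case False
    then obtain h where h: "h \<in> dual" "\<And>y. y \<in> K \<Longrightarrow> h y = 0" "h z \<noteq> 0" by blast
    \<comment> \<open>Subtracting this multiple of the evaluation at \<open>z\<close> makes
      \<open>\<psi>\<close> vanish at \<open>h\<close>.\<close>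
    define \<psi> where "\<psi> f = \<phi> f - \<phi> h / h z * f z" for f
    have "\<exists>w. \<forall>f\<in>dual. \<psi> f = f w"
    proof (rule insert.IH)
      fix f g :: "'a functional" and c
      assume f: "f \<in> dual"
      show "g \<in> dual \<Longrightarrow> \<psi> (f + g) = \<psi> f + \<psi> g"
        by (simp add: \<psi>_def insert.prems(1) f blinfun.add_left algebra_simps)
      show "\<psi> (scaleC_functional c f) = c * \<psi> f"
        by (simp add: \<psi>_def insert.prems(2) f algebra_simps)
      assume K: "\<And>y. y \<in> K \<Longrightarrow> f y = 0"
      \<comment> \<open>Correcting \<open>f\<close> by a multiple of \<open>h\<close> makes it
        vanish at \<open>z\<close> without disturbing \<open>K\<close>, so the kernel hypothesis for
        \<open>\<phi>\<close> applies.\<close>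
      let ?k = "f + scaleC_functional (- (f z / h z)) h"
      have "\<phi> ?k = 0"
        using f h K by (intro insert.prems(3)) (auto simp: dual_closed blinfun.add_left)
      moreover have "\<phi> ?k = \<phi> f - f z / h z * \<phi> h"
        by (simp add: insert.prems(1,2) f h(1) dual_closed)
      ultimately show "\<psi> f = 0" by (simp add: \<psi>_def)
    qed
    then obtain w where "\<And>f. f \<in> dual \<Longrightarrow> \<psi> f = f w" by blast
    then have "\<phi> f = f (w + scaleC (\<phi> h / h z) z)" if "f \<in> dual" for f
      using that by (simp add: \<psi>_def blinfun.add_right dual_scaleC diff_eq_eq)
    then show ?thesis by blast
  qed
qed

lemma topspace_weak_star [simp]: "topspace weak_star = dual"
  by (simp add: weak_star_def strong_operator_topology_topspace)

text \<open>A basic neighbourhood restricts only finitely many coordinates; these form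
  \<open>K\<close>.\<close>

lemma weak_star_nhd_zero:
  assumes "openin weak_star W" "0 \<in> W"
  obtains K where "finite K" "\<And>f. f \<in> dual \<Longrightarrow> (\<And>z. z \<in> K \<Longrightarrow> f z = 0) \<Longrightarrow> f \<in> W"
proof -
  obtain V where V: "openin strong_operator_topology V" "W = V \<inter> dual"
    using assms(1) by (auto simp: weak_star_def openin_subtopology)
  then obtain O' where O': "open O'" "V = blinfun_apply -` O'"
    by (auto simp: strong_operator_topology_def openin_pullback_topology)
  have "openin (product_topology (\<lambda>_. euclidean) UNIV) O'" "blinfun_apply 0 \<in> O'"
    using O' V(2) assms(2) by (auto simp: open_fun_def)
  from product_topology_open_contains_basis[OF this]
  obtain X where X: "\<And>z. blinfun_apply 0 z \<in> X z" "finite {z. X z \<noteq> UNIV}" "(\<Pi>\<^sub>E z\<in>UNIV. X z) \<subseteq> O'"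
    by (auto simp: PiE_iff)
  show ?thesis
  proof (rule that[OF X(2)])
    fix f assume f: "f \<in> dual" "\<And>z. z \<in> {z. X z \<noteq> UNIV} \<Longrightarrow> f z = 0"
    have "f z \<in> X z" for z
      using f(2)[of z] X(1)[of z] by (cases "X z = UNIV") auto
    then have "blinfun_apply f \<in> O'" using X(3) by (auto simp: PiE_iff)
    then show "f \<in> W" using f(1) O' V by simp
  qed
qed

text \<open>By continuity \<open>\<phi>\<close> is bounded by 1 on the functionals vanishing on a
  finite set \<open>K\<close>. These form a subspace, so \<open>\<phi>\<close> vanishes
  there.\<close>

lemma weak_star_continuous_functional:
  fixes \<phi> :: "'a::banach_lattice functional \<Rightarrow> complex"
  assumes cont: "continuous_map weak_star euclidean \<phi>"
    and add: "\<And>f g. f \<in> dual \<Longrightarrow> g \<in> dual \<Longrightarrow> \<phi> (f + g) = \<phi> f + \<phi> g"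
    and scale: "\<And>c f. f \<in> dual \<Longrightarrow> \<phi> (scaleC_functional c f) = c * \<phi> f"
  shows "\<exists>w. \<forall>f\<in>dual. \<phi> f = f w"
proof -
  have "openin weak_star {f \<in> topspace weak_star. \<phi> f \<in> ball 0 1}"
    using cont by (rule openin_continuous_map_preimage) simp
  moreover have "0 \<in> {f \<in> topspace weak_star. \<phi> f \<in> ball 0 1}"
    using add[of 0 0] by (simp add: dual_closed)
  ultimately obtain K where K: "finite K"
      "\<And>f. f \<in> dual \<Longrightarrow> (\<And>z. z \<in> K \<Longrightarrow> f z = 0) \<Longrightarrow> f \<in> {f \<in> topspace weak_star. \<phi> f \<in> ball 0 1}"
    by (rule weak_star_nhd_zero) blast
  show ?thesis
  proof (rule functional_of_finite_kernel[OF K(1) add scale])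
    fix f assume f: "f \<in> dual" "\<And>z. z \<in> K \<Longrightarrow> f z = 0"
    have "norm (c * \<phi> f) < 1" for c
      using K(2)[of "scaleC_functional c f"] f by (simp add: dual_closed scale)
    \<comment> \<open>With this \<open>c\<close> the product is 1 unless
      \<open>\<phi> f = 0\<close>.\<close>
    from this[of "inverse (\<phi> f)"] show "\<phi> f = 0" by (cases "\<phi> f = 0") auto
  qed
qed

lemma weak_star_continuous_evaluation: "continuous_map weak_star euclidean (\<lambda>f. blinfun_apply f z)"
  unfolding weak_star_def
  by (intro continuous_map_from_subtopology strong_operator_topology_continuous_evaluation)

text \<open>Continuity is tested coordinatewise: each \<open>f \<mapsto> U f z\<close> must be a
  weak*-continuous functional, that is, evaluation at some \<open>S z\<close>. The preadjoint
  \<open>S\<close> is obtained by choice.\<close>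

lemma weak_star_continuous_operator_iff:
  assumes U: "dual_operator U"
  shows "continuous_map weak_star weak_star U \<longleftrightarrow> (\<exists>S. \<forall>z. \<forall>f\<in>dual. U f z = f (S z))"
proof
  assume "continuous_map weak_star weak_star U"
  then have "continuous_map weak_star euclidean (\<lambda>f. U f z)" for z
    using continuous_map_compose[OF _ weak_star_continuous_evaluation] by (fastforce simp: o_def)
  then have "\<exists>w. \<forall>f\<in>dual. U f z = f w" for z
    using U by (intro weak_star_continuous_functional) (auto simp: dual_operator_def blinfun.add_left)
  then show "\<exists>S. \<forall>z. \<forall>f\<in>dual. U f z = f (S z)" by metis
next
  assume "\<exists>S. \<forall>z. \<forall>f\<in>dual. U f z = f (S z)"
  then obtain S where S: "\<And>z f. f \<in> dual \<Longrightarrow> U f z = f (S z)" by blast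
  have "continuous_map weak_star euclidean (\<lambda>f. U f z)" for z
    using S by (intro continuous_map_eq[OF weak_star_continuous_evaluation[of "S z"]]) simp
  then have "continuous_map weak_star strong_operator_topology U"
    by (simp add: continuous_on_strong_operator_topo_iff_coordinatewise)
  moreover have "U \<in> dual \<rightarrow> dual" using U by (auto simp: dual_operator_def)
  ultimately have "continuous_map weak_star (subtopology strong_operator_topology dual) U"
    by (simp add: continuous_map_in_subtopology image_subset_iff_funcset)
  then show "continuous_map weak_star weak_star U" by (simp flip: weak_star_def)
qed

section \<open>Suprema of increasing sequences of operators\<close>

text \<open>The nonnegative reals are closed in the complex plane. The index \<open>N\<close> admits
  sequences such as \<open>V m f - V n f\<close>, known to be positive from \<open>m = n\<close>
  on.\<close>

lemma dual_pos_limit: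
  assumes "\<And>n. n \<ge> N \<Longrightarrow> F n \<in> dual_pos" and g: "g \<in> dual"
    and lim: "\<And>z. (\<lambda>n. blinfun_apply (F n) z) \<longlonglongrightarrow> g z"
  shows "g \<in> dual_pos"
  unfolding dual_pos_def
proof (intro CollectI conjI g allI impI)
  fix x :: 'a assume "0 \<le> x"
  then show "g (Cplx x 0) \<in> \<real>\<^sub>\<ge>\<^sub>0"
    using assms(1) dual_posD(2)
    by (intro Lim_in_closed_set[OF closed_nonneg_Reals_complex _ _ lim])
      (auto simp: eventually_sequentially)
qed

lemma dual_le_antisym: "dual_le f g \<Longrightarrow> dual_le g f \<Longrightarrow> f \<in> dual \<Longrightarrow> g \<in> dual \<Longrightarrow> f = g"
  using dual_posD(3)[of "f - g"] dual_posD(3,4)[of "g - f"]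
  by (intro dual_eqI) (auto simp: dual_le_def blinfun.diff_left complex_eq_iff intro: antisym)

lemma is_dual_Sup_unique: "is_dual_Sup F g \<Longrightarrow> is_dual_Sup F h \<Longrightarrow> g = h"
  by (simp add: is_dual_Sup_def dual_le_antisym)

lemma op_le_chain:
  assumes "\<And>n. op_le (V n) (V (Suc n))" "n \<le> m"
  shows "op_le (V n) (V m)"
  using assms(2)
proof (induction m rule: dec_induct)
  case base
  then show ?case by (simp add: op_le_def positive_op_def dual_pos_def dual_closed)
next
  case (step m)
  have "V (Suc m) f - V n f \<in> dual_pos" if "f \<in> dual_pos" for f
    using dual_pos_add[of "V (Suc m) f - V m f" "V m f - V n f"] that assms(1)[of m] step.IH
    by (simp add: op_le_def positive_op_def)
  then show ?case by (simp add: op_le_def positive_op_def)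
qed

text \<open>Being an upper bound and being least are both positivity statements, which survive
  pointwise limits. The lemma serves the semigroups and the Laplace transforms alike.\<close>

lemma is_op_Sup_of_limit:
  assumes V: "\<And>n. dual_operator (V n)" and U: "dual_operator U"
    and incr: "\<And>n. op_le (V n) (V (Suc n))"
    and lim: "\<And>f z. f \<in> dual_pos \<Longrightarrow> (\<lambda>n. blinfun_apply (V n f) z) \<longlonglongrightarrow> U f z"
  shows "is_op_Sup V U"
  unfolding is_op_Sup_def is_dual_Sup_def
proof (intro conjI ballI allI impI U)
  fix f :: "'a functional" assume f: "f \<in> dual_pos"
  have dual: "U f \<in> dual" "V n f \<in> dual" for n
    using U V dual_posD(1)[OF f] by (auto simp: dual_operator_def)
  then show "U f \<in> dual" by simp
  show "dual_le (V n f) (U f)" for n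
    unfolding dual_le_def
  proof (rule dual_pos_limit)
    show "V m f - V n f \<in> dual_pos" if "m \<ge> n" for m
      using op_le_chain[of V, OF incr that] f by (simp add: op_le_def positive_op_def)
    show "(\<lambda>m. (V m f - V n f) z) \<longlonglongrightarrow> (U f - V n f) z" for z
      unfolding blinfun.diff_left by (intro tendsto_intros lim f)
  qed (simp add: dual dual_closed)
  fix h :: "'a functional" assume h: "h \<in> dual" "\<forall>n. dual_le (V n f) h"
  show "dual_le (U f) h"
    unfolding dual_le_def
  proof (rule dual_pos_limit)
    show "h - V m f \<in> dual_pos" for m using h(2) by (simp add: dual_le_def)
    show "(\<lambda>n. (h - V n f) z) \<longlonglongrightarrow> (h - U f) z" for z
      unfolding blinfun.diff_left by (intro tendsto_intros lim f)
  qed (simp add: h dual dual_closed)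
qed


section \<open>Limits of increasing positive contractions on the dual of a KB-space\<close>

lemma increasing_bounded_sequence_converges:
  fixes s :: "nat \<Rightarrow> 'a::kb_space"
  assumes "incseq s" "\<And>n. 0 \<le> s n" "\<And>n. norm (s n) \<le> M"
  shows "\<exists>l. s \<longlonglongrightarrow> l"
proof -
  have "\<exists>l. \<forall>e>0. \<exists>i0\<in>UNIV. \<forall>i\<in>UNIV. i0 \<le> i \<longrightarrow> norm (s i - l) < e"
    using assms
    by (intro kb_space_nets)
      (auto simp: directed_preorder_def incseq_def intro: max.cobounded1 max.cobounded2)
  then show ?thesis by (simp add: LIMSEQ_iff)
qed

text \<open>Used with \<open>V n = Tn n t\<close> for a fixed time \<open>t\<close>.\<close>

locale increasing_operators =
  fixes V :: "nat \<Rightarrow> 'a::kb_space functional \<Rightarrow> 'a functional"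
  assumes operator: "dual_operator (V n)"
    and continuous: "continuous_map weak_star weak_star (V n)"
    and positive: "positive_op (V n)"
    and contraction: "contraction_op (V n)"
    and increasing: "op_le (V n) (V (Suc n))"
begin

text \<open>The preadjoint vectors of \<open>x\<close> increase and are bounded, so they converge in
  norm. That \<open>w\<close> does not depend on \<open>f\<close> is what later gives weak*
  continuity of the limit.\<close>

lemma converges_on_positive:
  assumes "0 \<le> x"
  shows "\<exists>w. \<forall>f\<in>dual. (\<lambda>n. V n f (Cplx x 0)) \<longlonglongrightarrow> f w"
proof -
  have "\<forall>n. \<exists>w. \<forall>f\<in>dual. V n f (Cplx x 0) = f w"
    using weak_star_continuous_operator_iff[OF operator] continuous by blast
  then obtain S where S: "\<And>n f. f \<in> dual \<Longrightarrow> V n f (Cplx x 0) = f (S n)" by metis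
  define s where "s n = cre (S n)" for n
  \<comment> \<open>Positive functionals are nonnegative at \<open>S n\<close> because
    \<open>V n\<close> is positive, so \<open>S n\<close> is a nonnegative real vector; the same
    test on differences gives monotonicity.\<close>
  have "f (S n) \<in> \<real>\<^sub>\<ge>\<^sub>0" if "f \<in> dual_pos" for f n
    using that positive[of n] S[OF dual_posD(1)[OF that], of n] dual_posD(2)[OF _ assms]
    by (metis positive_op_def)
  then have s: "S n = Cplx (s n) 0" "0 \<le> s n" for n
    using nonneg_by_functionals[of "S n"] by (auto simp: s_def)
  have "f (Cplx (s (Suc n) - s n) 0) \<in> \<real>\<^sub>\<ge>\<^sub>0" if "f \<in> dual_pos" for f n
  proof -
    have "(V (Suc n) f - V n f) (Cplx x 0) \<in> \<real>\<^sub>\<ge>\<^sub>0"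
      using increasing[of n] that dual_posD(2)[OF _ assms] by (auto simp: op_le_def positive_op_def)
    then show ?thesis
      by (simp add: blinfun.diff_left blinfun.diff_right S[OF dual_posD(1)[OF that]] s Cplx_linear)
  qed
  then have "s n \<le> s (Suc n)" for n
    using nonneg_by_functionals(2)[of "Cplx (s (Suc n) - s n) 0"] by simp
  then have inc: "incseq s" by (rule incseq_SucI)
  \<comment> \<open>A positive functional norming \<open>s n\<close> moves the estimate to
    \<open>V n f\<close>, where contractivity applies; 2 is the bound on
    \<open>norm f\<close>.\<close>
  have bound: "norm (s n) \<le> 2 * norm x" for n
  proof -
    obtain f where f: "f \<in> dual_pos" "norm f \<le> 2" "norm (s n) \<le> Re (f (Cplx (s n) 0))"
      using dual_pos_norming[OF s(2)] by blast
    note fd = dual_posD(1)[OF f(1)]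
    have "norm (s n) \<le> norm (V n f (Cplx x 0))"
      using f(3) complex_Re_le_cmod order_trans by (auto simp: S[OF fd] s(1))
    also have "\<dots> \<le> norm (V n f) * norm x" using norm_blinfun[of "V n f" "Cplx x 0"] by simp
    also have "\<dots> \<le> 2 * norm x"
      using contraction[of n] fd f(2) by (intro mult_right_mono) (auto simp: contraction_op_def intro: order_trans)
    finally show ?thesis .
  qed
  obtain l where l: "s \<longlonglongrightarrow> l"
    using increasing_bounded_sequence_converges[OF inc s(2) bound] by blast
  have "(\<lambda>n. Cplx (s n) 0) \<longlonglongrightarrow> Cplx l 0"
    using l by (simp add: tendsto_iff dist_norm flip: Cplx_linear)
  then have "(\<lambda>n. V n f (Cplx x 0)) \<longlonglongrightarrow> f (Cplx l 0)" if "f \<in> dual" for f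
    by (simp add: S[OF that] s(1) blinfun.tendsto)
  then show ?thesis by blast
qed

lemma converges_pointwise: "\<exists>w. \<forall>f\<in>dual. (\<lambda>n. V n f z) \<longlonglongrightarrow> f w"
proof -
  obtain w where w: "\<And>x f. 0 \<le> x \<Longrightarrow> f \<in> dual \<Longrightarrow> (\<lambda>n. V n f (Cplx x 0)) \<longlonglongrightarrow> f (w x)"
    using converges_on_positive by metis
  \<comment> \<open>\<open>w\<close> is a choice made for nonnegative vectors; \<open>v\<close>
    extends it to real ones.\<close>
  define v where "v x = w \<bar>x\<bar> - w (\<bar>x\<bar> - x)" for x
  have v: "(\<lambda>n. V n f (Cplx x 0)) \<longlonglongrightarrow> f (v x)" if "f \<in> dual" for f x
    unfolding v_def blinfun.diff_right
    by (subst functional_eq_pos_parts) (intro tendsto_diff w that abs_diff_self_nonneg abs_ge_zero)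
  have "(\<lambda>n. V n f z) \<longlonglongrightarrow> f (v (cre z) + scaleC \<i> (v (cim z)))" if f: "f \<in> dual" for f
  proof -
    have "V n f z = V n f (Cplx (cre z) 0) + \<i> * V n f (Cplx (cim z) 0)" for n
      using f operator[of n] by (intro functional_eq_real_parts) (auto simp: dual_operator_def)
    moreover have "(\<lambda>n. V n f (Cplx (cre z) 0) + \<i> * V n f (Cplx (cim z) 0)) \<longlonglongrightarrow>
        f (v (cre z)) + \<i> * f (v (cim z))"
      by (intro tendsto_intros v f)
    ultimately show ?thesis using f by (simp add: blinfun.add_right dual_scaleC)
  qed
  then show ?thesis by blast
qed

text \<open>The limit operator is composition with a pointwise chosen \<open>S\<close>. Linearity of
  \<open>f (S z)\<close> in \<open>z\<close> follows from uniqueness of limits, boundedness from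
  contractivity.\<close>

lemma exists_limit:
  obtains U where "dual_operator U" "\<And>f z. f \<in> dual \<Longrightarrow> (\<lambda>n. V n f z) \<longlonglongrightarrow> U f z"
proof -
  obtain S where S: "\<And>z f. f \<in> dual \<Longrightarrow> (\<lambda>n. V n f z) \<longlonglongrightarrow> f (S z)"
    using converges_pointwise by metis
  define U where "U f = Blinfun (\<lambda>z. blinfun_apply f (S z))" for f :: "'a functional"
  have Vd: "V n f \<in> dual" if "f \<in> dual" for f n
    using operator[of n] that by (simp add: dual_operator_def)
  have "bounded_linear (\<lambda>z. f (S z))" if f: "f \<in> dual" for f
  proof (rule bounded_linear_intro)
    show "f (S (y + z)) = f (S y) + f (S z)" for y z
      using S[OF f, of "y + z"] tendsto_add[OF S[OF f, of y] S[OF f, of z]]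
      by (intro LIMSEQ_unique) (auto simp: blinfun.add_right)
    show "f (S (a *\<^sub>R z)) = a *\<^sub>R f (S z)" for a z
      using S[OF f, of "a *\<^sub>R z"] tendsto_scaleR[OF tendsto_const S[OF f, of z], of a]
      by (intro LIMSEQ_unique) (auto simp: blinfun.scaleR_right)
    show "norm (f (S z)) \<le> norm z * norm f" for z
    proof (rule LIMSEQ_le_const2[OF tendsto_norm[OF S[OF f]]], intro exI allI impI)
      fix n
      have "norm (V n f z) \<le> norm (V n f) * norm z" by (rule norm_blinfun)
      also have "\<dots> \<le> norm f * norm z"
        using contraction[of n] f by (intro mult_right_mono) (auto simp: contraction_op_def)
      finally show "norm (V n f z) \<le> norm z * norm f" by (simp add: ac_simps)
    qed
  qed
  then have U: "U f z = f (S z)" if "f \<in> dual" for f z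
    using that by (simp add: U_def bounded_linear_Blinfun_apply)
  have lim: "(\<lambda>n. V n f z) \<longlonglongrightarrow> U f z" if "f \<in> dual" for f z
    using S[OF that] U[OF that] by simp
  have "U f (scaleC c z) = c * U f z" if f: "f \<in> dual" for f c z
    using lim[OF f, of "scaleC c z"] tendsto_mult_left[OF lim[OF f, of z], of c]
    by (intro LIMSEQ_unique) (auto simp: dual_scaleC Vd f)
  then have "U f \<in> dual" if "f \<in> dual" for f
    using that by (simp add: dual_def)
  then have "dual_operator U"
    by (auto simp: dual_operator_def U dual_closed blinfun.add_left intro!: blinfun_eqI)
  then show ?thesis using lim that by blast
qed

text \<open>For the forward direction, \<open>U\<close> and the limit operator \<open>W\<close> are
  both suprema, hence agree on \<open>dual_pos\<close>, and \<open>dual_operator_eqI\<close> extends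
  this to \<open>dual\<close>.\<close>

lemma is_op_Sup_iff_limit:
  "is_op_Sup V U \<longleftrightarrow> dual_operator U \<and> (\<forall>f\<in>dual. \<forall>z. (\<lambda>n. V n f z) \<longlonglongrightarrow> U f z)"
proof
  assume U: "is_op_Sup V U"
  obtain W where W: "dual_operator W" "\<And>f z. f \<in> dual \<Longrightarrow> (\<lambda>n. V n f z) \<longlonglongrightarrow> W f z"
    using exists_limit by blast
  have "is_op_Sup V W"
    using W dual_posD(1) by (intro is_op_Sup_of_limit operator increasing) auto
  have "U f = W f" if "f \<in> dual" for f
  proof (rule dual_operator_eqI[OF _ W(1) _ that])
    show "dual_operator U" using U by (simp add: is_op_Sup_def)
    show "U g = W g" if "g \<in> dual_pos" for g
      using U \<open>is_op_Sup V W\<close> that is_dual_Sup_unique unfolding is_op_Sup_def by blast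
  qed
  then show "dual_operator U \<and> (\<forall>f\<in>dual. \<forall>z. (\<lambda>n. V n f z) \<longlonglongrightarrow> U f z)"
    using U W(2) by (auto simp: is_op_Sup_def)
next
  assume "dual_operator U \<and> (\<forall>f\<in>dual. \<forall>z. (\<lambda>n. V n f z) \<longlonglongrightarrow> U f z)"
  then show "is_op_Sup V U"
    using dual_posD(1) by (intro is_op_Sup_of_limit operator increasing) auto
qed

lemma exists_Sup: "\<exists>U. is_op_Sup V U"
  using exists_limit is_op_Sup_iff_limit by metis

lemma
  assumes "is_op_Sup V U"
  shows Sup_operator: "dual_operator U"
    and Sup_limit: "f \<in> dual \<Longrightarrow> (\<lambda>n. V n f z) \<longlonglongrightarrow> U f z"
    and Sup_continuous: "continuous_map weak_star weak_star U"
    and Sup_positive: "positive_op U"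
    and Sup_contraction: "contraction_op U"
    and Sup_upper: "op_le (V n) U"
proof -
  show op: "dual_operator U" and lim: "f \<in> dual \<Longrightarrow> (\<lambda>n. V n f z) \<longlonglongrightarrow> U f z" for f z
    using assms is_op_Sup_iff_limit by auto
  \<comment> \<open>The limit vector of \<open>converges_pointwise\<close> is the same for all
    \<open>f\<close>, which yields the preadjoint of \<open>U\<close>.\<close>
  have "\<exists>w. \<forall>f\<in>dual. U f z = f w" for z
    using converges_pointwise[of z] lim LIMSEQ_unique by blast
  then show "continuous_map weak_star weak_star U"
    unfolding weak_star_continuous_operator_iff[OF op] by metis
  show "positive_op U"
    unfolding positive_op_def
  proof
    fix f :: "'a functional" assume f: "f \<in> dual_pos"
    show "U f \<in> dual_pos"
    proof (rule dual_pos_limit)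
      show "V n f \<in> dual_pos" for n using positive[of n] f by (simp add: positive_op_def)
      show "U f \<in> dual" using op dual_posD(1)[OF f] by (simp add: dual_operator_def)
      show "(\<lambda>n. V n f z) \<longlonglongrightarrow> U f z" for z using dual_posD(1)[OF f] by (rule lim)
    qed
  qed
  show "contraction_op U"
    unfolding contraction_op_def
  proof (intro ballI norm_blinfun_bound)
    fix f :: "'a functional" and z assume f: "f \<in> dual"
    have "norm (V n f z) \<le> norm f * norm z" for n
      using contraction[of n] f
      by (intro order_trans[OF norm_blinfun] mult_right_mono) (auto simp: contraction_op_def)
    then show "norm (U f z) \<le> norm f * norm z"
      by (intro LIMSEQ_le_const2[OF tendsto_norm[OF lim[OF f]]]) auto
  qed auto
  show "op_le (V n) U"
    using assms by (auto simp: is_op_Sup_def is_dual_Sup_def dual_le_def op_le_def positive_op_def)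
qed

end

section \<open>Semigroups and Laplace transforms\<close>

lemma op_le_Re:
  assumes "op_le U V" "f \<in> dual_pos" "0 \<le> x"
  shows "Re (U f (Cplx x 0)) \<le> Re (V f (Cplx x 0))"
  using assms dual_posD(3)[of "V f - U f" x] by (simp add: op_le_def positive_op_def blinfun.diff_left)

lemma positive_op_Re_mono:
  assumes "positive_op U" "dual_operator U" "g - f \<in> dual_pos" "f \<in> dual" "g \<in> dual" "0 \<le> x"
  shows "Re (U f (Cplx x 0)) \<le> Re (U g (Cplx x 0))"
proof -
  have "U g = U (f + (g - f))" by simp
  also have "\<dots> = U f + U (g - f)"
    using assms(2,3,4) dual_posD(1) unfolding dual_operator_def by blast
  finally have "U g (Cplx x 0) = U f (Cplx x 0) + U (g - f) (Cplx x 0)" by (simp add: blinfun.add_left)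
  then show ?thesis
    using assms dual_posD(3)[of "U (g - f)" x] by (simp add: positive_op_def)
qed

section \<open>Laplace integrals, their limits and their order\<close>

lemma integrable_exp_minus_lebesgue_on:
  fixes a :: real
  assumes "a > 0"
  shows "integrable (lebesgue_on {0<..}) (\<lambda>t. exp (- a * t))"
proof -
  have "(\<lambda>t. exp (- a * t)) absolutely_integrable_on {0..}"
    by (intro nonnegative_absolutely_integrable_1 integrable_on_exp_minus_to_infinity assms) simp
  then have "(\<lambda>t. exp (- a * t)) absolutely_integrable_on {0<..}"
    by (rule set_integrable_subset) auto
  then show ?thesis by (simp add: set_integrable_def integrable_restrict_space)
qed

text \<open>The common majorant, integrable for \<open>Re \<mu> > 0\<close>: it gives integrability,
  boundedness of the transform and dominated convergence.\<close>

lemma norm_Laplace_integrand: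
  assumes "contraction_op U" "f \<in> dual"
  shows "norm (exp (- \<mu> * of_real t) * U f z) \<le> norm f * norm z * exp (- Re \<mu> * t)"
proof -
  have "norm (U f z) \<le> norm (U f) * norm z" by (rule norm_blinfun)
  also have "\<dots> \<le> norm f * norm z"
    using assms by (intro mult_right_mono) (auto simp: contraction_op_def)
  finally show ?thesis
    using mult_left_mono[of "norm (U f z)" "norm f * norm z" "exp (- Re \<mu> * t)"]
    by (simp add: norm_mult norm_exp_eq_Re ac_simps)
qed

lemma Laplace_integrand_measurable:
  assumes "star_semigroup T" "f \<in> dual"
  shows "(\<lambda>t. exp (- \<mu> * of_real t) * T t f z) \<in> borel_measurable (lebesgue_on {0<..})"
proof -
  have "(\<lambda>t. exp (- \<mu> * of_real t)) \<in> borel_measurable (lebesgue_on {0<..})"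
    by (intro continuous_imp_measurable_on_sets_lebesgue continuous_intros) auto
  then show ?thesis
    using assms by (intro borel_measurable_times) (auto simp: star_semigroup_def)
qed

lemma Laplace_integrand_integrable:
  assumes T: "contractive_semigroup T" and f: "f \<in> dual" and \<mu>: "Re \<mu> > 0"
  shows "integrable (lebesgue_on {0<..}) (\<lambda>t. exp (- \<mu> * of_real t) * T t f z)"
proof (rule Bochner_Integration.integrable_bound)
  show "integrable (lebesgue_on {0<..}) (\<lambda>t. norm f * norm z * exp (- Re \<mu> * t))"
    using integrable_exp_minus_lebesgue_on[OF \<mu>] by simp
  show "(\<lambda>t. exp (- \<mu> * of_real t) * T t f z) \<in> borel_measurable (lebesgue_on {0<..})"
    using T f by (intro Laplace_integrand_measurable) (auto simp: contractive_semigroup_def)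
  show "AE t in lebesgue_on {0<..}. norm (exp (- \<mu> * of_real t) * T t f z)
      \<le> norm (norm f * norm z * exp (- Re \<mu> * t))"
    using T f norm_Laplace_integrand[of _ f \<mu> _ z] by (intro AE_I2) (auto simp: contractive_semigroup_def)
qed

text \<open>For fixed \<open>\<mu>\<close> and \<open>f\<close> the integral is a bounded functional
  of \<open>z\<close>, with bound \<open>norm f\<close> times the integral of
  \<open>exp (- Re \<mu> * t)\<close>.\<close>

lemma exists_Laplace_transform:
  fixes T :: "real \<Rightarrow> 'a::banach_lattice functional \<Rightarrow> 'a functional"
  assumes T: "contractive_semigroup T"
  shows "\<exists>R. is_Laplace_transform T R"
proof -
  let ?M = "lebesgue_on {0<..} :: real measure"
  define I where "I \<mu> f z = (LINT t|?M. exp (- \<mu> * of_real t) * T t f z)" for \<mu> f z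
  define R where "R \<mu> f = Blinfun (I \<mu> f)" for \<mu> f
  have Td: "T t f \<in> dual" "T t (f + g) = T t f + T t g"
    "T t (scaleC_functional c f) = scaleC_functional c (T t f)"
    if "f \<in> dual" "g \<in> dual" "t > 0" for t f g c
    using T that by (auto simp: contractive_semigroup_def star_semigroup_def dual_operator_def)
  have R: "R \<mu> f z = I \<mu> f z" "R \<mu> f \<in> dual" if \<mu>: "Re \<mu> > 0" and f: "f \<in> dual" for \<mu> f z
  proof -
    note int = Laplace_integrand_integrable[OF T f \<mu>]
    have "bounded_linear (I \<mu> f)"
    proof (rule bounded_linear_intro)
      show "I \<mu> f (y + z) = I \<mu> f y + I \<mu> f z" for y z
        unfolding I_def blinfun.add_right distrib_left by (rule Bochner_Integration.integral_add[OF int int])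
      show "I \<mu> f (a *\<^sub>R z) = a *\<^sub>R I \<mu> f z" for a z
        by (simp add: I_def blinfun.scaleR_right flip: integral_scaleR_right)
      show "norm (I \<mu> f z) \<le> norm z * (norm f * (LINT t|?M. exp (- Re \<mu> * t)))" for z
      proof -
        have "norm (I \<mu> f z) \<le> (LINT t|?M. norm f * norm z * exp (- Re \<mu> * t))"
          unfolding I_def
          using T f norm_Laplace_integrand[of _ f \<mu> _ z] integrable_exp_minus_lebesgue_on[OF \<mu>]
          by (intro Bochner_Integration.integral_norm_bound_integral int) (auto simp: contractive_semigroup_def)
        then show ?thesis by (simp add: ac_simps)
      qed
    qed
    then show R: "R \<mu> f z = I \<mu> f z" for z by (simp add: R_def bounded_linear_Blinfun_apply)
    have "I \<mu> f (scaleC c z) = c * I \<mu> f z" for c z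
    proof -
      have "I \<mu> f (scaleC c z) = (LINT t|?M. c * (exp (- \<mu> * of_real t) * T t f z))"
        unfolding I_def using f by (intro Bochner_Integration.integral_cong) (auto simp: dual_scaleC Td)
      then show ?thesis by (simp add: I_def)
    qed
    then show "R \<mu> f \<in> dual" by (simp add: dual_def R)
  qed
  have "R \<mu> (f + g) = R \<mu> f + R \<mu> g" if "Re \<mu> > 0" "f \<in> dual" "g \<in> dual" for \<mu> f g
  proof (rule blinfun_eqI)
    fix z
    have "I \<mu> (f + g) z = (LINT t|?M. exp (- \<mu> * of_real t) * T t f z + exp (- \<mu> * of_real t) * T t g z)"
      unfolding I_def using that
      by (intro Bochner_Integration.integral_cong) (auto simp: Td blinfun.add_left algebra_simps)
    also have "\<dots> = I \<mu> f z + I \<mu> g z"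
      unfolding I_def using that
      by (intro Bochner_Integration.integral_add Laplace_integrand_integrable[OF T])
    finally show "R \<mu> (f + g) z = (R \<mu> f + R \<mu> g) z"
      using that by (simp add: R dual_closed blinfun.add_left)
  qed
  moreover have "R \<mu> (scaleC_functional c f) = scaleC_functional c (R \<mu> f)" if "Re \<mu> > 0" "f \<in> dual" for \<mu> f c
  proof (rule blinfun_eqI)
    fix z
    have "I \<mu> (scaleC_functional c f) z = (LINT t|?M. c * (exp (- \<mu> * of_real t) * T t f z))"
      unfolding I_def using that by (intro Bochner_Integration.integral_cong) (auto simp: Td(3)[of f f])
    then show "R \<mu> (scaleC_functional c f) z = scaleC_functional c (R \<mu> f) z"
      using that by (simp add: R dual_closed I_def)
  qed
  ultimately have "is_Laplace_transform T R"
    unfolding is_Laplace_transform_def dual_operator_def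
    using R Laplace_integrand_integrable[OF T] by (simp add: I_def)
  then show ?thesis by blast
qed

text \<open>Dominated convergence; contractivity provides a majorant independent of
  \<open>n\<close>.\<close>

lemma Laplace_transform_limit:
  assumes Tn: "\<And>n. contractive_semigroup (Tn n)" and Rn: "\<And>n. is_Laplace_transform (Tn n) (Rn n)"
    and T: "contractive_semigroup T" and R: "is_Laplace_transform T R"
    and lim: "\<And>t. t > 0 \<Longrightarrow> (\<lambda>n. Tn n t f z) \<longlonglongrightarrow> T t f z" and f: "f \<in> dual" and \<mu>: "Re \<mu> > 0"
  shows "(\<lambda>n. Rn n \<mu> f z) \<longlonglongrightarrow> R \<mu> f z"
proof -
  let ?M = "lebesgue_on {0<..} :: real measure"
  have "(\<lambda>n. LINT t|?M. exp (- \<mu> * of_real t) * Tn n t f z) \<longlonglongrightarrow>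
      (LINT t|?M. exp (- \<mu> * of_real t) * T t f z)"
  proof (rule integral_dominated_convergence)
    show "(\<lambda>t. exp (- \<mu> * of_real t) * T t f z) \<in> borel_measurable ?M"
      "(\<lambda>t. exp (- \<mu> * of_real t) * Tn n t f z) \<in> borel_measurable ?M" for n
      using T Tn by (intro Laplace_integrand_measurable f; simp add: contractive_semigroup_def)+
    show "integrable ?M (\<lambda>t. norm f * norm z * exp (- Re \<mu> * t))"
      using integrable_exp_minus_lebesgue_on[OF \<mu>] by simp
    show "AE t in ?M. (\<lambda>n. exp (- \<mu> * of_real t) * Tn n t f z) \<longlonglongrightarrow> exp (- \<mu> * of_real t) * T t f z"
      by (intro AE_I2 tendsto_mult_left lim) simp
    show "AE t in ?M. norm (exp (- \<mu> * of_real t) * Tn n t f z) \<le> norm f * norm z * exp (- Re \<mu> * t)" for n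
      using Tn[of n] f norm_Laplace_integrand[of _ f \<mu> _ z] by (intro AE_I2) (auto simp: contractive_semigroup_def)
  qed
  then show ?thesis using Rn R f \<mu> by (simp add: is_Laplace_transform_def)
qed

text \<open>For real \<open>\<mu>\<close> the exponential weight is positive, so the order of the
  semigroups passes through the integral.\<close>

lemma Laplace_transform_mono:
  assumes R: "is_Laplace_transform T R" and S: "is_Laplace_transform T' R'"
    and le: "\<And>t. t > 0 \<Longrightarrow> op_le (T t) (T' t)" and \<mu>: "\<mu> > 0"
  shows "op_le (R (of_real \<mu>)) (R' (of_real \<mu>))"
proof -
  let ?M = "lebesgue_on {0<..} :: real measure"
  have "R' (of_real \<mu>) f - R (of_real \<mu>) f \<in> dual_pos" if f: "f \<in> dual_pos" for f
    unfolding dual_pos_def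
  proof (intro CollectI conjI allI impI)
    note fd = dual_posD(1)[OF f]
    show "R' (of_real \<mu>) f - R (of_real \<mu>) f \<in> dual"
      using R S \<mu> fd by (auto simp: is_Laplace_transform_def dual_operator_def intro!: dual_closed)
    fix x :: 'a assume x: "0 \<le> x"
    define h where "h t = exp (- of_real \<mu> * of_real t) * T' t f (Cplx x 0) -
      exp (- of_real \<mu> * of_real t) * T t f (Cplx x 0)" for t :: real
    have h: "integrable ?M h" "(R' (of_real \<mu>) f - R (of_real \<mu>) f) (Cplx x 0) = integral\<^sup>L ?M h"
      using R S \<mu> fd by (auto simp: is_Laplace_transform_def h_def[abs_def] blinfun.diff_left)
    have pos: "Re (h t) \<ge> 0" "Im (h t) = 0" if "t > 0" for t
    proof -
      have "h t = of_real (exp (- \<mu> * t)) * (T' t f - T t f) (Cplx x 0)"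
        by (simp add: h_def blinfun.diff_left algebra_simps exp_of_real[symmetric])
      then show "Re (h t) \<ge> 0" "Im (h t) = 0"
        using le[OF that] f dual_posD(3,4)[of "T' t f - T t f" x] x
        by (simp_all add: op_le_def positive_op_def)
    qed
    have "Re (integral\<^sup>L ?M h) = (LINT t|?M. Re (h t))" "Im (integral\<^sup>L ?M h) = (LINT t|?M. Im (h t))"
      using h(1) by simp_all
    moreover have "(LINT t|?M. Re (h t)) \<ge> 0" using pos by (intro Bochner_Integration.integral_nonneg) auto
    moreover have "(LINT t|?M. Im (h t)) = (LINT t|?M. 0)"
      using pos by (intro Bochner_Integration.integral_cong) auto
    ultimately show "(R' (of_real \<mu>) f - R (of_real \<mu>) f) (Cplx x 0) \<in> \<real>\<^sub>\<ge>\<^sub>0"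
      by (simp add: h(2) complex_nonneg_Reals_iff)
  qed
  then show ?thesis by (simp add: op_le_def positive_op_def)
qed

text \<open>\<open>is_op_Sup\<close> fixes an operator only on \<open>dual\<close>, so the result
  speaks of every family \<open>T\<close> of suprema. For \<open>R\<close> existence is enough: its
  values on \<open>dual\<close> are prescribed by integrals for \<open>Re \<mu> > 0\<close>.\<close>

theorem proposition2p12:
  fixes Tn :: "nat \<Rightarrow> real \<Rightarrow> 'a::kb_space functional \<Rightarrow> 'a functional"
    and Rn :: "nat \<Rightarrow> complex \<Rightarrow> 'a functional \<Rightarrow> 'a functional"
  assumes separable: "separable_space (euclidean :: 'a topology)"
    and pos: "\<And>n. positive_semigroup (Tn n)"
    and contr: "\<And>n. contractive_semigroup (Tn n)"
    and incr: "\<And>n t. t > 0 \<Longrightarrow> op_le (Tn n t) (Tn (Suc n) t)"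
    and laplace: "\<And>n. is_Laplace_transform (Tn n) (Rn n)"
  shows "(\<forall>t>0. \<exists>U. is_op_Sup (\<lambda>n. Tn n t) U) \<and>
    (\<forall>T. (\<forall>t>0. is_op_Sup (\<lambda>n. Tn n t) (T t)) \<longrightarrow>
      positive_semigroup T \<and> contractive_semigroup T \<and>
      (\<exists>R. is_Laplace_transform T R \<and>
        (\<forall>\<mu>::real. \<mu> > 0 \<longrightarrow> is_op_Sup (\<lambda>n. Rn n (of_real \<mu>)) (R (of_real \<mu>)))))"
proof (intro conjI allI impI)
  have ops: "increasing_operators (\<lambda>n. Tn n t)" if "t > 0" for t
    using pos contr incr that
    by unfold_locales (auto simp: positive_semigroup_def contractive_semigroup_def star_semigroup_def)
  show "\<exists>U. is_op_Sup (\<lambda>n. Tn n t) U" if "t > 0" for t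
    using ops[OF that] by (rule increasing_operators.exists_Sup)
  fix T :: "real \<Rightarrow> 'a functional \<Rightarrow> 'a functional"
  assume Sup: "\<forall>t>0. is_op_Sup (\<lambda>n. Tn n t) (T t)"
  \<comment> \<open>Both \<open>ops\<close> and \<open>Sup\<close> contribute a premise
    \<open>t > 0\<close>, so these facts take it twice, as in \<open>op[OF t t]\<close>; those from
    \<open>Tn_op\<close> on take it once.\<close>
  note op = increasing_operators.Sup_operator[OF ops Sup[rule_format]]
    and lim = increasing_operators.Sup_limit[OF ops Sup[rule_format]]
    and cont = increasing_operators.Sup_continuous[OF ops Sup[rule_format]]
    and Tpos = increasing_operators.Sup_positive[OF ops Sup[rule_format]]
    and Tcontr = increasing_operators.Sup_contraction[OF ops Sup[rule_format]]
    and upper = increasing_operators.Sup_upper[OF ops Sup[rule_format]]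
    and Tn_op = increasing_operators.operator[OF ops]
    and Tn_pos = increasing_operators.positive[OF ops]
    and Tn_cont = increasing_operators.continuous[OF ops]
  have dual: "T t f \<in> dual" "Tn n t f \<in> dual" if "t > 0" "f \<in> dual" for t f n
    using op[of t] Tn_op[of t n] that by (auto simp: dual_operator_def)
  have Tn_add: "Tn n (t + s) f = Tn n t (Tn n s f)" if "t > 0" "s > 0" "f \<in> dual" for n t s f
    using contr[of n] that by (auto simp: contractive_semigroup_def star_semigroup_def)
  \<comment> \<open>By linearity and \<open>dual_eqI\<close> it suffices to compare values of
    nonnegative functionals at nonnegative vectors; these are real, so two inequalities of real
    parts remain.\<close>
  have semigroup: "T (t + s) f = T t (T s f)" if t: "t > 0" and s: "s > 0" and "f \<in> dual" for t s f
  proof (rule dual_operator_eqI[of "T (t + s)" "\<lambda>f. T t (T s f)", OF _ _ _ \<open>f \<in> dual\<close>])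
    show "dual_operator (T (t + s))" using t s by (intro op add_pos_pos)+
    show "dual_operator (\<lambda>f. T t (T s f))" using op[OF t t] op[OF s s] by (auto simp: dual_operator_def)
    fix f :: "'a functional" assume f: "f \<in> dual_pos"
    note fd = dual_posD(1)[OF f]
    show "T (t + s) f = T t (T s f)"
    proof (rule dual_eqI)
      fix x :: 'a assume x: "0 \<le> x"
      let ?z = "Cplx x 0"
      have ts: "t + s > 0" using t s by simp
      have Tsf: "T s f \<in> dual_pos" using Tpos[OF s s] f by (simp add: positive_op_def)
      have "T (t + s) f \<in> dual_pos" "T t (T s f) \<in> dual_pos"
        using Tpos[OF ts ts] Tpos[OF t t] f Tsf by (auto simp: positive_op_def)
      then have Im: "Im (T (t + s) f ?z) = 0" "Im (T t (T s f) ?z) = 0"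
        using x by (auto dest: dual_posD(4))
      \<comment> \<open>\<open>T\<^sub>n(t) T\<^sub>n(s) \<le> T\<^sub>n(t) T(s) \<le> T(t)
        T(s)\<close>; afterwards \<open>n\<close> tends to infinity.\<close>
      have "Re (Tn n (t + s) f ?z) \<le> Re (T t (T s f) ?z)" for n
      proof -
        have "Re (Tn n t (Tn n s f) ?z) \<le> Re (Tn n t (T s f) ?z)"
          using upper[OF s s, of n] f
          by (intro positive_op_Re_mono Tn_pos Tn_op dual t s fd x)
            (simp add: op_le_def positive_op_def)
        also have "\<dots> \<le> Re (T t (T s f) ?z)" by (intro op_le_Re upper t Tsf x)
        finally show ?thesis by (simp add: Tn_add t s fd)
      qed
      then have le: "Re (T (t + s) f ?z) \<le> Re (T t (T s f) ?z)"
        by (intro LIMSEQ_le_const2[OF tendsto_Re[OF lim[OF ts ts fd]]]) auto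
      \<comment> \<open>For fixed \<open>m\<close> and \<open>n \<ge> m\<close>, \<open>T\<^sub>m(t)
        T\<^sub>n(s) \<le> T\<^sub>n(t) T\<^sub>n(s) = T\<^sub>n(t + s) \<le> T(t + s)\<close>; then
        \<open>n\<close> tends to infinity.\<close>
      have "Re (Tn m t (T s f) ?z) \<le> Re (T (t + s) f ?z)" for m
      proof -
        obtain S where S: "\<And>z f. f \<in> dual \<Longrightarrow> Tn m t f z = f (S z)"
          using Tn_cont[OF t, of m] weak_star_continuous_operator_iff[OF Tn_op[OF t]] by blast
        \<comment> \<open>The preadjoint of \<open>T\<^sub>m(t)\<close> turns the left side into
          \<open>Tn n s f\<close> at the fixed vector \<open>S ?z\<close>.\<close>
        have "(\<lambda>n. Tn m t (Tn n s f) ?z) \<longlonglongrightarrow> Tn m t (T s f) ?z"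
          using lim[OF s s fd, of "S ?z"] by (simp add: S dual s fd)
        moreover have "Re (Tn m t (Tn n s f) ?z) \<le> Re (T (t + s) f ?z)" if "n \<ge> m" for n
        proof -
          have "Tn n s f \<in> dual_pos" using Tn_pos[OF s] f by (simp add: positive_op_def)
          then have "Re (Tn m t (Tn n s f) ?z) \<le> Re (Tn n t (Tn n s f) ?z)"
            by (intro op_le_Re[OF op_le_chain[of "\<lambda>n. Tn n t", OF incr[OF t] that]] x)
          also have "\<dots> \<le> Re (T (t + s) f ?z)"
            using op_le_Re[OF upper[OF ts ts] f x, of n] by (simp add: Tn_add t s fd)
          finally show ?thesis .
        qed
        ultimately show ?thesis by (intro LIMSEQ_le_const2[OF tendsto_Re]) auto
      qed
      \<comment> \<open>Now \<open>m\<close> tends to infinity, at the functional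
        \<open>T s f\<close>.\<close>
      then have "Re (T t (T s f) ?z) \<le> Re (T (t + s) f ?z)"
        by (intro LIMSEQ_le_const2[OF tendsto_Re[OF lim[OF t t dual(1)[OF s fd]]]]) auto
      with le Im show "T (t + s) f ?z = T t (T s f) ?z" by (simp add: complex_eq_iff)
    qed (intro dual add_pos_pos t s fd)+
  qed
  have meas: "(\<lambda>t. T t f z) \<in> borel_measurable (lebesgue_on {0<..})" if "f \<in> dual" for f z
  proof (rule borel_measurable_LIMSEQ_metric)
    show "(\<lambda>t. Tn n t f z) \<in> borel_measurable (lebesgue_on {0<..})" for n
      using contr[of n] that by (simp add: contractive_semigroup_def star_semigroup_def)
    show "(\<lambda>n. Tn n t f z) \<longlonglongrightarrow> T t f z" if "t \<in> space (lebesgue_on {0<..})" for t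
      using that \<open>f \<in> dual\<close> by (intro lim) auto
  qed
  have star: "star_semigroup T"
    using op cont semigroup meas by (auto simp: star_semigroup_def)
  then show "positive_semigroup T" using Tpos by (auto simp: positive_semigroup_def)
  show contrT: "contractive_semigroup T" using star Tcontr by (auto simp: contractive_semigroup_def)
  obtain R where R: "is_Laplace_transform T R" using exists_Laplace_transform[OF contrT] by blast
  \<comment> \<open>The transforms inherit monotonicity and pointwise convergence from the
    semigroups, so their limit is their supremum.\<close>
  have "is_op_Sup (\<lambda>n. Rn n (of_real \<mu>)) (R (of_real \<mu>))" if \<mu>: "\<mu> > 0" for \<mu> :: real
  proof (rule is_op_Sup_of_limit)
    show "dual_operator (Rn n (of_real \<mu>))" "dual_operator (R (of_real \<mu>))" for n
      using laplace R \<mu> by (auto simp: is_Laplace_transform_def)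
    show "op_le (Rn n (of_real \<mu>)) (Rn (Suc n) (of_real \<mu>))" for n
      using \<mu> by (intro Laplace_transform_mono[OF laplace laplace] incr)
    show "(\<lambda>n. Rn n (of_real \<mu>) f z) \<longlonglongrightarrow> R (of_real \<mu>) f z" if "f \<in> dual_pos" for f z
      using \<mu> dual_posD(1)[OF that]
      by (intro Laplace_transform_limit[OF contr laplace contrT R]) (auto intro: lim)
  qed
  then show "\<exists>R. is_Laplace_transform T R \<and>
      (\<forall>\<mu>::real. \<mu> > 0 \<longrightarrow> is_op_Sup (\<lambda>n. Rn n (of_real \<mu>)) (R (of_real \<mu>)))"
    using R by blast
qed

end
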